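(* Let $T$ be a perfect binary tree of height $h>0$ with vertex set $\{x_1,\dots,x_n\}$, let $S=\mathbb K[x_1,\dots,x_n]$ be the polynomial ring over a field $\mathbb K$, and let $I\subseteq S$ be the edge ideal of $T$. Let $p_h=\operatorname{pd}_S(S/I)$ be the projective dimension of $S/I$. Then the last total Betti number of $S/I$ is $\beta_{p_h}(S/I)=1$.
   Context: A perfect binary tree is a rooted tree in which every non-leaf vertex has exactly two children and all leaves lie at the same distance (number of edges) from the root; this common distance is the height $h$ of the tree. It is regarded as a finite simple graph. For a finite simple graph $G$ with vertices $x_1,\dots,x_n$ (identified with the variables of $S$), the edge ideal is $I(G)=(x_ix_j : \{x_i,x_j\}\in E(G))\subseteq S$. The projective dimension $\operatorname{pd}_S(S/I)$ is the length of the minimal graded free resolution of $S/I$ over $S$. The $i$-th total Betti number is $\beta_i(S/I)=\sum_j\beta_{i,j}(S/I)=\dim_{\mathbb K}\operatorname{Tor}_i^S(S/I,\mathbb K)$, i.e. the rank of the $i$-th free module in the minimal graded free resolution of $S/I$, where $\mathbb K=S/(x_1,\dots,x_n)$. *)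

theory Defs
  imports
    "HOL-Library.Poly_Mapping"
    "Jordan_Normal_Form.Matrix"
begin

section \<open>Perfect binary trees\<close>

text \<open>A finite graph is given by its set of edges \<open>E :: 'v set set\<close>; its vertex set is the whole
  finite type \<open>'v\<close>. Walks are nonempty lists of vertices, so a walk with \<open>Suc n\<close> vertices has
  length \<open>n\<close>.\<close>

definition simple_graph :: "'v set set \<Rightarrow> bool" where
  "simple_graph E \<longleftrightarrow> (\<forall>e\<in>E. card e = 2)"

definition is_walk :: "'v set set \<Rightarrow> 'v list \<Rightarrow> bool" where
  "is_walk E xs \<longleftrightarrow> xs \<noteq> [] \<and> successively (\<lambda>u v. {u, v} \<in> E) xs"

definition walk_betw :: "'v set set \<Rightarrow> 'v \<Rightarrow> 'v \<Rightarrow> 'v list \<Rightarrow> bool" where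
  "walk_betw E u v xs \<longleftrightarrow> is_walk E xs \<and> hd xs = u \<and> last xs = v"

definition connected_graph :: "'v set set \<Rightarrow> bool" where
  "connected_graph E \<longleftrightarrow> (\<forall>u v. \<exists>xs. walk_betw E u v xs)"

definition is_cycle :: "'v set set \<Rightarrow> 'v list \<Rightarrow> bool" where
  "is_cycle E xs \<longleftrightarrow> is_walk E xs \<and> distinct xs \<and> length xs \<ge> 3 \<and> {last xs, hd xs} \<in> E"

definition is_tree :: "'v set set \<Rightarrow> bool" where
  "is_tree E \<longleftrightarrow> simple_graph E \<and> connected_graph E \<and> (\<nexists>xs. is_cycle E xs)"

definition graph_dist :: "'v set set \<Rightarrow> 'v \<Rightarrow> 'v \<Rightarrow> nat" where
  "graph_dist E u v = (LEAST n. \<exists>xs. walk_betw E u v xs \<and> length xs = Suc n)"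

definition children :: "'v set set \<Rightarrow> 'v \<Rightarrow> 'v \<Rightarrow> 'v set" where
  "children E r v = {w. {v, w} \<in> E \<and> graph_dist E r w = Suc (graph_dist E r v)}"

text \<open>The leaves of a rooted tree are its vertices without children.\<close>

definition perfect_binary_tree :: "'v set set \<Rightarrow> nat \<Rightarrow> bool" where
  "perfect_binary_tree E h \<longleftrightarrow> is_tree E \<and>
    (\<exists>r. \<forall>v. (children E r v \<noteq> {} \<longrightarrow> card (children E r v) = 2) \<and>
             (children E r v = {} \<longrightarrow> graph_dist E r v = h))"


section \<open>The polynomial ring and edge ideals\<close>

text \<open>The polynomial ring over \<open>'k\<close> whose variables are the elements of \<open>'v\<close>: monomials are
  finitely supported exponent vectors, and multiplication is the convolution product.\<close>

type_synonym ('v, 'k) polyring = "('v \<Rightarrow>\<^sub>0 nat) \<Rightarrow>\<^sub>0 'k"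

definition pvar :: "'v \<Rightarrow> ('v, 'k::field) polyring" where
  "pvar x = Poly_Mapping.single (Poly_Mapping.single x 1) 1"

definition ideal_gen :: "('v, 'k::field) polyring set \<Rightarrow> ('v, 'k) polyring set" where
  "ideal_gen = Modules.module.span (*)"

definition irrelevant_ideal :: "('v, 'k::field) polyring set" where
  "irrelevant_ideal = ideal_gen {pvar x | x. True}"

definition edge_ideal :: "'v set set \<Rightarrow> ('v, 'k::field) polyring set" where
  "edge_ideal E = ideal_gen {pvar x * pvar y | x y. {x, y} \<in> E}"

definition mon_degree :: "('v::finite \<Rightarrow>\<^sub>0 nat) \<Rightarrow> nat" where
  "mon_degree m = (\<Sum>x\<in>UNIV. Poly_Mapping.lookup m x)"

text \<open>Zero is homogeneous of every degree, and is the only homogeneous element of negative degree.\<close>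

definition homogeneous :: "int \<Rightarrow> ('v::finite, 'k::field) polyring \<Rightarrow> bool" where
  "homogeneous d p \<longleftrightarrow> (\<forall>m\<in>Poly_Mapping.keys p. int (mon_degree m) = d)"


section \<open>Minimal graded free resolutions of S/I\<close>

text \<open>A sequence \<open>\<cdots> \<rightarrow> F\<^sub>2 \<rightarrow> F\<^sub>1 \<rightarrow> F\<^sub>0 \<rightarrow> S/I\<close> of maps between finitely generated graded free
  \<open>S\<close>-modules. The list \<open>shifts F i\<close> contains the degrees of the basis elements of \<open>F\<^sub>i\<close>, that is,
  \<open>F\<^sub>i\<close> is the direct sum of the modules \<open>S(-d)\<close> for \<open>d\<close> in \<open>shifts F i\<close>; elements of \<open>F\<^sub>i\<close> are
  column vectors. The matrix \<open>boundary F i\<close> represents the map \<open>F\<^sub>i\<^sub>+\<^sub>1 \<rightarrow> F\<^sub>i\<close>. The entries of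
  \<open>augmentation F\<close> represent the images in \<open>S/I\<close> of the basis elements of \<open>F\<^sub>0\<close>, so that
  \<open>v \<in> F\<^sub>0\<close> is mapped to the class of \<open>augmentation F \<bullet> v\<close> modulo \<open>I\<close>.\<close>

record 's free_complex =
  shifts :: "nat \<Rightarrow> int list"
  augmentation :: "'s vec"
  boundary :: "nat \<Rightarrow> 's mat"

definition free_rank :: "'s free_complex \<Rightarrow> nat \<Rightarrow> nat" where
  "free_rank F i = length (shifts F i)"

definition mat_image :: "'s::semiring_0 mat \<Rightarrow> 's vec set" where
  "mat_image A = {A *\<^sub>v w | w. w \<in> carrier_vec (dim_col A)}"

text \<open>All maps are homogeneous of degree 0.\<close>

definition graded_free_complex :: "('v::finite, 'k::field) polyring free_complex \<Rightarrow> bool" where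
  "graded_free_complex F \<longleftrightarrow>
     augmentation F \<in> carrier_vec (free_rank F 0) \<and>
     (\<forall>k < free_rank F 0. homogeneous (shifts F 0 ! k) (augmentation F $ k)) \<and>
     (\<forall>i. boundary F i \<in> carrier_mat (free_rank F i) (free_rank F (Suc i)) \<and>
       (\<forall>k < free_rank F i. \<forall>l < free_rank F (Suc i).
          homogeneous (shifts F (Suc i) ! l - shifts F i ! k) (boundary F i $$ (k, l))))"

text \<open>The conjuncts after the first say that the sequence is exact at \<open>S/I\<close>, at \<open>F\<^sub>0\<close>, and at
  \<open>F\<^sub>i\<close> for all \<open>i > 0\<close>.\<close>

definition graded_free_resolution ::
  "('v::finite, 'k::field) polyring set \<Rightarrow> ('v, 'k) polyring free_complex \<Rightarrow> bool" where
  "graded_free_resolution I F \<longleftrightarrow> graded_free_complex F \<and>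
     (\<forall>p. \<exists>v \<in> carrier_vec (free_rank F 0). p - augmentation F \<bullet> v \<in> I) \<and>
     (\<forall>v \<in> carrier_vec (free_rank F 0).
        augmentation F \<bullet> v \<in> I \<longleftrightarrow> v \<in> mat_image (boundary F 0)) \<and>
     (\<forall>i. \<forall>v \<in> carrier_vec (free_rank F (Suc i)).
        boundary F i *\<^sub>v v = 0\<^sub>v (free_rank F i) \<longleftrightarrow> v \<in> mat_image (boundary F (Suc i)))"

text \<open>Minimality: the image of \<open>F\<^sub>i\<^sub>+\<^sub>1\<close> lies in \<open>\<mm> F\<^sub>i\<close>, where \<open>\<mm>\<close> is the irrelevant ideal.\<close>

definition minimal_graded_free_resolution ::
  "('v::finite, 'k::field) polyring set \<Rightarrow> ('v, 'k) polyring free_complex \<Rightarrow> bool" where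
  "minimal_graded_free_resolution I F \<longleftrightarrow> graded_free_resolution I F \<and>
     (\<forall>i. elements_mat (boundary F i) \<subseteq> irrelevant_ideal)"

text \<open>For a homogeneous ideal \<open>I\<close>, a minimal graded free resolution of \<open>S/I\<close> exists and is unique up
  to isomorphism. By Hilbert's syzygy theorem it has finite length.\<close>

definition the_min_resolution ::
  "('v::finite, 'k::field) polyring set \<Rightarrow> ('v, 'k) polyring free_complex" where
  "the_min_resolution I = (SOME F. minimal_graded_free_resolution I F)"

definition proj_dim :: "('v::finite, 'k::field) polyring set \<Rightarrow> nat" where
  "proj_dim I = (LEAST p. \<forall>i > p. free_rank (the_min_resolution I) i = 0)"

definition betti :: "('v::finite, 'k::field) polyring set \<Rightarrow> nat \<Rightarrow> nat" where
  "betti I i = free_rank (the_min_resolution I) i"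

end

theory Submission
  imports Defs "Jordan_Normal_Form.Determinant"
begin

text \<open>
Why the last Betti number is 1. Let \<open>I\<close> be a squarefree monomial ideal, \<open>x\<close> a variable that divides no
generator of \<open>I\<close>, and \<open>m\<close> a squarefree monomial without \<open>x\<close>. Then \<open>x\<close> is a nonzerodivisor modulo \<open>I\<close>,
and multiplication by \<open>xm\<close> gives the exact sequence
\<open>0 \<rightarrow> S/(I : m) \<rightarrow> S/I \<rightarrow> S/(I + (xm)) \<rightarrow> 0\<close> (up to a shift). Multiplication by \<open>xm\<close> lifts to the
resolutions as \<open>x\<close> times a lift of multiplication by \<open>m\<close>, so all entries of the lift lie in the
irrelevant ideal and the mapping cone of two minimal resolutions is again minimal. Hence
\<open>\<beta>\<^sub>i(S/(I + (xm))) = \<beta>\<^sub>i(S/I) + \<beta>\<^sub>i\<^sub>-\<^sub>1(S/(I : m))\<close>. For \<open>m = 1\<close> the Betti polynomial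
\<open>P(t) = \<Sum>\<beta>\<^sub>i t\<^sup>i\<close> is multiplied by \<open>1 + t\<close>. For \<open>m = y\<close> one adds a leaf \<open>x\<close> at \<open>y\<close> to a graph \<open>E\<close>: the
colon ideal is generated by the \<open>n\<close> neighbours of \<open>y\<close> and the edges that avoid \<open>y\<close> and its neighbours,
so \<open>t (1 + t)\<^sup>n P(E - N[y])\<close> is added to the Betti polynomial of \<open>E\<close>.

Iterating these cones gives a minimal graded free resolution of the edge ideal of a forest. The
inductive predicate \<open>last_betti A d c\<close> records only what is needed of it: length at most \<open>d\<close> and rank \<open>c\<close>
in position \<open>d\<close>. Any two minimal resolutions have equal ranks (\<open>minimal_resolution_rank_unique\<close>), so this
determines \<open>betti\<close> and \<open>proj_dim\<close>, which refer to an arbitrarily chosen minimal resolution.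

The combinatorial step is \<open>last_betti_attach_tree\<close>. Let a graph \<open>E\<close> have \<open>P\<close> of degree \<open>d\<close>, and attach to a
vertex \<open>q\<close> of degree at most 2 (or to nothing) the root \<open>p\<close> of a perfect binary tree of height 2, with
children \<open>y\<close> and \<open>z\<close>. Adding the second leaf at \<open>y\<close> last, where \<open>y\<close> already has two neighbours,
contributes \<open>t (1 + t)\<^sup>2\<close> times the polynomial of \<open>E\<close> together with the three vertices of the path
through \<open>z\<close>, which is \<open>(1 + t)\<^sup>2 P\<close>. So this term has degree \<open>d + 5\<close> and the leading coefficient of \<open>P\<close>.
All other cones have smaller degree, because deleting vertices of \<open>E\<close> cannot raise the degree
(\<open>last_betti_delete_vertices\<close>). Thus cutting off all subtrees of height 2 at the bottom of a perfect
binary tree of height \<open>h\<close> lowers the projective dimension by 5 for each of them, keeps the last Betti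
number, and leaves the perfect binary tree of height \<open>h - 3\<close>. Depending on \<open>h\<close> modulo 3, the process ends
with the empty graph, a single vertex, or a path of three vertices; for each, the last Betti number is 1.
\<close>

section \<open>Monomials and constant terms\<close>

lemma poly_mapping_expand:
  "p = (\<Sum>m\<in>Poly_Mapping.keys p. Poly_Mapping.single m (Poly_Mapping.lookup p m))"
  by (rule poly_mapping_eqI)
     (auto simp: lookup_sum lookup_single when_def in_keys_iff sum.delta[OF finite_keys])

lemma keys_add_nat:
  fixes a b :: "'v \<Rightarrow>\<^sub>0 nat"
  shows "Poly_Mapping.keys (a + b) = Poly_Mapping.keys a \<union> Poly_Mapping.keys b"
  by (auto simp: in_keys_iff lookup_add)

lemma lookup_monomial_mult:
  fixes m :: "'v \<Rightarrow>\<^sub>0 nat" and p :: "('v, 'k::field) polyring"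
  shows "Poly_Mapping.lookup (Poly_Mapping.single m 1 * p) (m + k) = Poly_Mapping.lookup p k"
proof -
  have "Poly_Mapping.single m 1 * p =
      (\<Sum>j\<in>Poly_Mapping.keys p. Poly_Mapping.single (m + j) (Poly_Mapping.lookup p j))"
    by (subst (1) poly_mapping_expand[of p]) (simp add: sum_distrib_left mult_single)
  then show ?thesis
    by (auto simp: lookup_sum lookup_single when_def in_keys_iff sum.delta[OF finite_keys])
qed

lemma keys_monomial_mult:
  fixes m :: "'v \<Rightarrow>\<^sub>0 nat" and p :: "('v, 'k::field) polyring"
  shows "Poly_Mapping.keys (Poly_Mapping.single m 1 * p) = (+) m ` Poly_Mapping.keys p"
proof
  show "Poly_Mapping.keys (Poly_Mapping.single m 1 * p) \<subseteq> (+) m ` Poly_Mapping.keys p"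
    using keys_mult[of "Poly_Mapping.single m 1" p] by auto
  show "(+) m ` Poly_Mapping.keys p \<subseteq> Poly_Mapping.keys (Poly_Mapping.single m 1 * p)"
    by (auto simp: in_keys_iff lookup_monomial_mult)
qed

lemma lookup_mult_zero:
  fixes p q :: "('v, 'k::field) polyring"
  shows "Poly_Mapping.lookup (p * q) 0 = Poly_Mapping.lookup p 0 * Poly_Mapping.lookup q 0"
proof -
  have z: "(0 = l + r) \<longleftrightarrow> l = 0 \<and> r = 0" for l r :: "'v \<Rightarrow>\<^sub>0 nat"
    using keys_add_nat[of l r] by (metis Un_empty keys_eq_empty add_0)
  have "(\<Sum>r. Poly_Mapping.lookup q r when 0 = l + r) = (Poly_Mapping.lookup q 0 when l = 0)" for l
  proof -
    have "(\<lambda>r. Poly_Mapping.lookup q r when 0 = l + r)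
        = (\<lambda>r. (Poly_Mapping.lookup q r when l = 0) when r = 0)"
      by (auto simp: z when_def)
    then show ?thesis by (simp only: Sum_any_when_equal)
  qed
  then show ?thesis by (simp add: lookup_mult mult_when)
qed

section \<open>Homogeneous components\<close>

lift_definition hom_component ::
  "int \<Rightarrow> ('v::finite, 'k::field) polyring \<Rightarrow> ('v, 'k) polyring" is
  "\<lambda>d p m. if int (mon_degree m) = d then p m else 0"
  by (rule finite_subset) auto

lemma hom_component_add: "hom_component d (p + q) = hom_component d p + hom_component d q"
  by transfer auto

lemma hom_component_zero [simp]: "hom_component d 0 = 0"
  by transfer auto

lemma hom_component_minus: "hom_component d (p - q) = hom_component d p - hom_component d q"
  by transfer auto

lemma hom_component_sum: "hom_component d (sum f A) = (\<Sum>a\<in>A. hom_component d (f a))"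
  by (induction A rule: infinite_finite_induct) (auto simp: hom_component_add)

lemma keys_hom_component:
  "Poly_Mapping.keys (hom_component d p) = {m \<in> Poly_Mapping.keys p. int (mon_degree m) = d}"
  by transfer auto

lemma homogeneous_hom_component: "homogeneous d (hom_component d p)"
  by (simp add: homogeneous_def keys_hom_component)

lemma hom_component_homogeneous: "homogeneous d p \<Longrightarrow> hom_component d p = p"
  by (rule poly_mapping_eqI)
     (auto simp: homogeneous_def hom_component.rep_eq in_keys_iff)

lemma hom_component_eq_0: "(\<And>m. m \<in> Poly_Mapping.keys p \<Longrightarrow> int (mon_degree m) \<noteq> d) \<Longrightarrow> hom_component d p = 0"
  by (rule poly_mapping_eqI) (force simp: hom_component.rep_eq in_keys_iff)

lemma mon_degree_add: "mon_degree (a + b) = mon_degree a + mon_degree b"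
  by (simp add: mon_degree_def lookup_add sum.distrib)

lemma homogeneous_0 [simp]: "homogeneous d 0"
  by (simp add: homogeneous_def)

lemma homogeneous_1: "homogeneous 0 1"
  by (simp add: homogeneous_def mon_degree_def)

lemma homogeneous_mult: "homogeneous d p \<Longrightarrow> homogeneous e q \<Longrightarrow> homogeneous (d + e) (p * q)"
  using keys_mult[of p q] by (fastforce simp: homogeneous_def mon_degree_add)

lemma homogeneous_add: "homogeneous d p \<Longrightarrow> homogeneous d q \<Longrightarrow> homogeneous d (p + q)"
  using keys_add[of p q] by (fastforce simp: homogeneous_def)

lemma homogeneous_uminus: "homogeneous d p \<Longrightarrow> homogeneous d (- p)"
  by (simp add: homogeneous_def in_keys_iff)

text \<open>Only \<open>p\<close> is split here: multiplying the components of \<open>p\<close> of the other degrees by \<open>a\<close> gives nothing in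
degree \<open>d + e\<close>. This is what makes lifts of homogeneous maps homogeneous.\<close>

lemma hom_component_mult:
  assumes "homogeneous d a"
  shows "hom_component (d + e) (a * p) = a * hom_component e p"
proof -
  define r where "r = p - hom_component e p"
  have r: "int (mon_degree m) \<noteq> e" if "m \<in> Poly_Mapping.keys r" for m
    using that by (auto simp: r_def in_keys_iff lookup_minus hom_component.rep_eq split: if_splits)
  have "hom_component (d + e) (a * r) = 0"
    using keys_mult[of a r] r assms
    by (intro hom_component_eq_0) (fastforce simp: homogeneous_def mon_degree_add)
  moreover have "hom_component (d + e) (a * hom_component e p) = a * hom_component e p"
    by (intro hom_component_homogeneous homogeneous_mult assms homogeneous_hom_component)
  moreover have "a * p = a * r + a * hom_component e p"
    by (simp add: r_def algebra_simps)
  ultimately show ?thesis by (simp add: hom_component_add)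
qed

section \<open>Squarefree monomial ideals\<close>

definition monomial_of :: "'v::finite set \<Rightarrow> ('v \<Rightarrow>\<^sub>0 nat)" where
  "monomial_of s = (\<Sum>v\<in>s. Poly_Mapping.single v 1)"

text \<open>The squarefree monomial ideal generated by the monomials with supports in \<open>A\<close>, described by membership:
a polynomial lies in a monomial ideal iff each of its monomials is divisible by a generator, and
divisibility by a squarefree monomial depends on the support alone.\<close>

definition sqfree_ideal :: "'v::finite set set \<Rightarrow> ('v, 'k::field) polyring set" where
  "sqfree_ideal A = {p. \<forall>m\<in>Poly_Mapping.keys p. \<exists>s\<in>A. s \<subseteq> Poly_Mapping.keys m}"

text \<open>This captures all that the homological arguments use of the ideal; it is not phrased with generators, so
that it can be checked directly on \<^const>\<open>sqfree_ideal\<close>.\<close>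

definition homogeneous_ideal :: "('v::finite, 'k::field) polyring set \<Rightarrow> bool" where
  "homogeneous_ideal I \<longleftrightarrow> 0 \<in> I \<and> (\<forall>p\<in>I. \<forall>q\<in>I. p + q \<in> I) \<and> (\<forall>p\<in>I. \<forall>c. c * p \<in> I) \<and>
     (\<forall>p\<in>I. \<forall>d. hom_component d p \<in> I)"

lemma lookup_monomial_of: "Poly_Mapping.lookup (monomial_of s) v = (if v \<in> s then 1 else 0)"
  by (simp add: monomial_of_def lookup_sum lookup_single when_def)

lemma keys_monomial_of: "Poly_Mapping.keys (monomial_of s) = s"
  by (auto simp: in_keys_iff lookup_monomial_of split: if_splits)

lemma mon_degree_monomial_of: "mon_degree (monomial_of s) = card s"
  by (simp add: mon_degree_def lookup_monomial_of flip: sum.inter_filter)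

lemma homogeneous_ideal_sqfree:
  "homogeneous_ideal (sqfree_ideal A :: ('v::finite, 'k::field) polyring set)"
proof -
  have "c * p \<in> sqfree_ideal A" if p: "p \<in> sqfree_ideal A" for c p :: "('v, 'k) polyring"
    unfolding sqfree_ideal_def
  proof safe
    fix m assume "m \<in> Poly_Mapping.keys (c * p)"
    then obtain a b where m: "m = a + b" "b \<in> Poly_Mapping.keys p"
      using keys_mult[of c p] by auto
    then obtain s where "s \<in> A" "s \<subseteq> Poly_Mapping.keys b"
      using p by (auto simp: sqfree_ideal_def)
    then show "\<exists>s\<in>A. s \<subseteq> Poly_Mapping.keys m"
      using m(1) by (auto simp: keys_add_nat)
  qed
  moreover have "p + q \<in> sqfree_ideal A" if "p \<in> sqfree_ideal A" "q \<in> sqfree_ideal A"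
    for p q :: "('v, 'k) polyring"
    using that keys_add[of p q] unfolding sqfree_ideal_def by blast
  moreover have "0 \<in> sqfree_ideal A" by (simp add: sqfree_ideal_def)
  moreover have "hom_component d p \<in> sqfree_ideal A" if "p \<in> sqfree_ideal A"
    for d and p :: "('v, 'k) polyring"
    using that by (simp add: sqfree_ideal_def keys_hom_component)
  ultimately show ?thesis
    unfolding homogeneous_ideal_def by blast
qed

lemma homogeneous_idealD:
  assumes "homogeneous_ideal I"
  shows homogeneous_ideal_0: "0 \<in> I"
    and homogeneous_ideal_add: "p \<in> I \<Longrightarrow> q \<in> I \<Longrightarrow> p + q \<in> I"
    and homogeneous_ideal_mult: "p \<in> I \<Longrightarrow> c * p \<in> I"
    and homogeneous_ideal_component: "p \<in> I \<Longrightarrow> hom_component d p \<in> I"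
  using assms by (auto simp: homogeneous_ideal_def)

lemma homogeneous_ideal_minus:
  assumes "homogeneous_ideal I" "p \<in> I" "q \<in> I"
  shows "p - q \<in> I"
proof -
  have "p + (- 1) * q \<in> I"
    by (intro homogeneous_ideal_add[OF assms(1)] homogeneous_ideal_mult[OF assms(1)] assms)
  then show ?thesis by simp
qed

lemma homogeneous_ideal_sum:
  assumes "homogeneous_ideal I" "\<And>a. a \<in> A \<Longrightarrow> f a \<in> I"
  shows "sum f A \<in> I"
  using assms(2)
  by (induction A rule: infinite_finite_induct) (use assms(1) in \<open>auto simp: homogeneous_ideal_def\<close>)

text \<open>The colon ideal by a squarefree monomial with support \<open>s\<close> is again squarefree: drop \<open>s\<close> from every
generator. If no generator meets \<open>s\<close>, then the monomial is a nonzerodivisor modulo the ideal.\<close>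

lemma monomial_mult_in_sqfree_ideal:
  "Poly_Mapping.single (monomial_of s) 1 * p \<in> sqfree_ideal A \<longleftrightarrow>
   p \<in> sqfree_ideal ((\<lambda>t. t - s) ` A)"
  by (simp add: sqfree_ideal_def keys_monomial_mult keys_add_nat keys_monomial_of Diff_subset_conv)

lemma single_eq_mult_monomial_of:
  assumes "s \<subseteq> Poly_Mapping.keys m"
  shows "(Poly_Mapping.single m c :: ('v::finite, 'k::field) polyring) =
    Poly_Mapping.single (m - monomial_of s) c * Poly_Mapping.single (monomial_of s) 1"
proof -
  have "(m - monomial_of s) + monomial_of s = m"
    using assms by (intro poly_mapping_eqI)
      (auto simp: lookup_add lookup_minus lookup_monomial_of in_keys_iff subset_iff)
  then show ?thesis by (simp add: mult_single)
qed

lemma sqfree_ideal_insert: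
  "(sqfree_ideal (insert s A) :: ('v::finite, 'k::field) polyring set) =
     {a + c * Poly_Mapping.single (monomial_of s) 1 | a c. a \<in> sqfree_ideal A}"
  (is "?L = ?R")
proof
  have hi: "homogeneous_ideal (sqfree_ideal A :: ('v, 'k) polyring set)" by (rule homogeneous_ideal_sqfree)
  have add: "p + q \<in> ?R" if pq: "p \<in> ?R" "q \<in> ?R" for p q :: "('v, 'k) polyring"
  proof -
    obtain a c where a: "p = a + c * Poly_Mapping.single (monomial_of s) 1" "a \<in> sqfree_ideal A"
      using pq(1) by blast
    obtain b d where b: "q = b + d * Poly_Mapping.single (monomial_of s) 1" "b \<in> sqfree_ideal A"
      using pq(2) by blast
    have "p + q = (a + b) + (c + d) * Poly_Mapping.single (monomial_of s) 1"
      unfolding a(1) b(1) by (simp add: algebra_simps)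
    moreover have "a + b \<in> sqfree_ideal A"
      by (rule homogeneous_ideal_add[OF hi a(2) b(2)])
    ultimately show ?thesis by blast
  qed
  show "?L \<subseteq> ?R"
  proof
    fix p :: "('v, 'k) polyring"
    assume p: "p \<in> ?L"
    have *: "Poly_Mapping.single m (Poly_Mapping.lookup p m) \<in> ?R" if m: "m \<in> Poly_Mapping.keys p" for m
    proof (cases "s \<subseteq> Poly_Mapping.keys m")
      case True
      have "Poly_Mapping.single m (Poly_Mapping.lookup p m) =
          0 + Poly_Mapping.single (m - monomial_of s) (Poly_Mapping.lookup p m) *
          Poly_Mapping.single (monomial_of s) 1"
        by (simp add: single_eq_mult_monomial_of[OF True, symmetric])
      moreover have "0 \<in> sqfree_ideal A" by (simp add: sqfree_ideal_def)
      ultimately show ?thesis by blast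
    next
      case False
      then have "Poly_Mapping.single m (Poly_Mapping.lookup p m) \<in> sqfree_ideal A"
        using p m by (auto simp: sqfree_ideal_def)
      then show ?thesis
        by (intro CollectI exI[of _ "Poly_Mapping.single m (Poly_Mapping.lookup p m)"]
            exI[of _ 0]) simp
    qed
    have "(\<Sum>m\<in>M. Poly_Mapping.single m (Poly_Mapping.lookup p m)) \<in> ?R"
      if "finite M" "M \<subseteq> Poly_Mapping.keys p" for M
      using that
    proof (induction M)
      case empty
      have "0 \<in> sqfree_ideal A" by (simp add: sqfree_ideal_def)
      then show ?case by (intro CollectI exI[of _ 0]) simp
    next
      case (insert m M)
      have "Poly_Mapping.single m (Poly_Mapping.lookup p m) +
          (\<Sum>m\<in>M. Poly_Mapping.single m (Poly_Mapping.lookup p m)) \<in> ?R"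
        by (rule add[OF * insert.IH]) (use insert.prems in auto)
      then show ?case by (simp only: sum.insert[OF insert.hyps])
    qed
    from this[OF finite_keys order_refl] show "p \<in> ?R"
      by (simp only: poly_mapping_expand[symmetric])
  qed
  show "?R \<subseteq> ?L"
  proof
    fix p :: "('v, 'k) polyring"
    assume "p \<in> ?R"
    then obtain a c where p: "p = a + c * Poly_Mapping.single (monomial_of s) 1" "a \<in> sqfree_ideal A"
      by blast
    have "a \<in> ?L" using p(2) unfolding sqfree_ideal_def by blast
    moreover have "Poly_Mapping.single (monomial_of s) 1 \<in> ?L"
      by (auto simp: sqfree_ideal_def keys_monomial_of)
    ultimately show "p \<in> ?L"
      unfolding p(1)
      by (intro homogeneous_ideal_add[OF homogeneous_ideal_sqfree]
          homogeneous_ideal_mult[OF homogeneous_ideal_sqfree])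
  qed
qed

lemma module_polyring: "Modules.module ((*) :: ('v, 'k::field) polyring \<Rightarrow> _)"
  by standard (auto simp: algebra_simps)

lemma sqfree_ideal_subspace:
  "Modules.module.subspace (*) (sqfree_ideal A :: ('v::finite, 'k::field) polyring set)"
  using homogeneous_ideal_sqfree[of A]
  by (auto simp: Modules.module.subspace_def[OF module_polyring] homogeneous_ideal_def)

lemma ideal_gen_sqfree:
  "ideal_gen ((\<lambda>s. Poly_Mapping.single (monomial_of s) 1) ` A) =
     (sqfree_ideal A :: ('v::finite, 'k::field) polyring set)"
  (is "ideal_gen ?G = _")
proof
  show "ideal_gen ?G \<subseteq> (sqfree_ideal A :: ('v, 'k) polyring set)"
    unfolding ideal_gen_def
    by (rule Modules.module.span_minimal[OF module_polyring _ sqfree_ideal_subspace])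
       (auto simp: sqfree_ideal_def keys_monomial_of)
  show "(sqfree_ideal A :: ('v, 'k) polyring set) \<subseteq> ideal_gen ?G"
  proof
    fix p :: "('v, 'k) polyring" assume p: "p \<in> sqfree_ideal A"
    have "Poly_Mapping.single m (Poly_Mapping.lookup p m) \<in> ideal_gen ?G"
      if m: "m \<in> Poly_Mapping.keys p" for m
    proof -
      obtain s where s: "s \<in> A" "s \<subseteq> Poly_Mapping.keys m"
        using p m by (auto simp: sqfree_ideal_def)
      have "Poly_Mapping.single m (Poly_Mapping.lookup p m) =
          Poly_Mapping.single (m - monomial_of s) (Poly_Mapping.lookup p m) *
          Poly_Mapping.single (monomial_of s) 1"
        by (rule single_eq_mult_monomial_of[OF s(2)])
      also have "\<dots> \<in> ideal_gen ?G"
        unfolding ideal_gen_def using s(1)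
        by (intro Modules.module.span_scale[OF module_polyring] Modules.module.span_base[OF module_polyring]) auto
      finally show ?thesis .
    qed
    then have "(\<Sum>m\<in>Poly_Mapping.keys p. Poly_Mapping.single m (Poly_Mapping.lookup p m)) \<in> ideal_gen ?G"
      unfolding ideal_gen_def by (intro Modules.module.span_sum[OF module_polyring])
    then show "p \<in> ideal_gen ?G" by (simp only: poly_mapping_expand[symmetric])
  qed
qed

lemma edge_ideal_eq_sqfree_ideal:
  assumes "simple_graph E"
  shows "(edge_ideal E :: ('v::finite, 'k::field) polyring set) = sqfree_ideal E"
proof -
  have m: "pvar x * pvar y = (Poly_Mapping.single (monomial_of {x, y}) 1 :: ('v, 'k) polyring)"
    if "{x, y} \<in> E" for x y
    using that assms
  proof -
    have "x \<noteq> y" using that assms by (auto simp: simple_graph_def)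
    then show ?thesis by (simp add: pvar_def mult_single monomial_of_def)
  qed
  have "{pvar x * pvar y | x y. {x, y} \<in> E} =
      ((\<lambda>s. Poly_Mapping.single (monomial_of s) 1) ` E :: ('v, 'k) polyring set)"
  proof (intro equalityI subsetI)
    fix p :: "('v, 'k) polyring"
    assume "p \<in> (\<lambda>s. Poly_Mapping.single (monomial_of s) 1) ` E"
    then obtain s where s: "s \<in> E" "p = Poly_Mapping.single (monomial_of s) 1" by blast
    have "card s = 2" using s(1) assms by (simp add: simple_graph_def)
    then obtain x y where xy: "s = {x, y}" by (auto simp: card_2_iff)
    then have "{x, y} \<in> E" using s(1) by simp
    moreover have "p = pvar x * pvar y" unfolding s(2) xy by (rule m[OF calculation, symmetric])
    ultimately show "p \<in> {pvar x * pvar y | x y. {x, y} \<in> E}" by blast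
  next
    fix p :: "('v, 'k) polyring"
    assume "p \<in> {pvar x * pvar y | x y. {x, y} \<in> E}"
    then obtain x y where xy: "p = pvar x * pvar y" "{x, y} \<in> E" by blast
    show "p \<in> (\<lambda>s. Poly_Mapping.single (monomial_of s) 1) ` E"
      unfolding xy(1) m[OF xy(2)] using xy(2) by (rule imageI)
  qed
  then show ?thesis by (simp only: edge_ideal_def ideal_gen_sqfree)
qed

lemma irrelevant_ideal_eq_sqfree_ideal:
  "(irrelevant_ideal :: ('v::finite, 'k::field) polyring set) = sqfree_ideal (range (\<lambda>v. {v}))"
proof -
  have "{pvar x | x. True} =
      ((\<lambda>s. Poly_Mapping.single (monomial_of s) 1) ` range (\<lambda>v. {v}) :: ('v, 'k) polyring set)"
    by (simp add: pvar_def monomial_of_def full_SetCompr_eq image_image)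
  then show ?thesis by (simp only: irrelevant_ideal_def ideal_gen_sqfree)
qed

lemma lookup_0_irrelevant:
  assumes "p \<in> (irrelevant_ideal :: ('v::finite, 'k::field) polyring set)"
  shows "Poly_Mapping.lookup p 0 = 0"
proof (rule ccontr)
  assume "Poly_Mapping.lookup p 0 \<noteq> 0"
  then have "0 \<in> Poly_Mapping.keys p" by (simp add: in_keys_iff)
  then have "\<exists>s\<in>range (\<lambda>v::'v. {v}). s \<subseteq> Poly_Mapping.keys (0 :: 'v \<Rightarrow>\<^sub>0 nat)"
    using assms unfolding irrelevant_ideal_eq_sqfree_ideal sqfree_ideal_def by blast
  then show False by auto
qed

lemma irrelevant_ideal_homogeneous: "homogeneous_ideal (irrelevant_ideal :: ('v::finite, 'k::field) polyring set)"
  by (simp add: irrelevant_ideal_eq_sqfree_ideal homogeneous_ideal_sqfree)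

lemma monomial_in_irrelevant_ideal:
  "s \<noteq> {} \<Longrightarrow>
    (Poly_Mapping.single (monomial_of s) 1 :: ('v::finite, 'k::field) polyring) \<in> irrelevant_ideal"
  by (auto simp: irrelevant_ideal_eq_sqfree_ideal sqfree_ideal_def keys_monomial_of)

section \<open>Graded matrices and lifting\<close>

definition graded_mat ::
  "int list \<Rightarrow> int list \<Rightarrow> ('v::finite, 'k::field) polyring mat \<Rightarrow> bool" where
  "graded_mat r s A \<longleftrightarrow> A \<in> carrier_mat (length r) (length s) \<and>
     (\<forall>k < length r. \<forall>l < length s. homogeneous (s ! l - r ! k) (A $$ (k, l)))"

lemma graded_mat_carrier: "graded_mat r s A \<Longrightarrow> A \<in> carrier_mat (length r) (length s)"
  by (simp add: graded_mat_def)

lemma mat_image_iff: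
  "A \<in> carrier_mat n m \<Longrightarrow> v \<in> mat_image A \<longleftrightarrow> (\<exists>w\<in>carrier_vec m. v = A *\<^sub>v w)"
  by (auto simp: mat_image_def)

lemma mult_mat_unit_vec:
  "(A :: 'a::comm_ring_1 mat) \<in> carrier_mat n m \<Longrightarrow> j < m \<Longrightarrow> A *\<^sub>v unit_vec m j = col A j"
  by (intro eq_vecI) auto

lemma mult_mat_zero_vec:
  "(A :: 'a::comm_ring_1 mat) \<in> carrier_mat n m \<Longrightarrow> A *\<^sub>v 0\<^sub>v m = 0\<^sub>v n"
  by (intro eq_vecI) auto

lemma mat_lift:
  assumes A: "(A :: 'a::comm_ring_1 mat) \<in> carrier_mat n m" and B: "B \<in> carrier_mat n l"
    and im: "\<And>j. j < l \<Longrightarrow> col B j \<in> mat_image A"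
  shows "\<exists>X\<in>carrier_mat m l. A * X = B"
proof -
  have "\<forall>j\<in>{..<l}. \<exists>w. w \<in> carrier_vec m \<and> col B j = A *\<^sub>v w"
    using im mat_image_iff[OF A] by blast
  then obtain w where w: "\<And>j. j < l \<Longrightarrow> w j \<in> carrier_vec m" "\<And>j. j < l \<Longrightarrow> col B j = A *\<^sub>v w j"
    by (metis lessThan_iff)
  define X where "X = mat m l (\<lambda>(i, j). w j $ i)"
  have X: "X \<in> carrier_mat m l" by (simp add: X_def)
  have "col X j = w j" if "j < l" for j
    using that w(1)[OF that] by (intro eq_vecI) (auto simp: X_def)
  then have "A * X = B"
    using A B X w(2) by (intro mat_col_eqI) (auto simp: col_mult2[OF A X])
  then show ?thesis using X by blast
qed

text \<open>A lift through \<open>A\<close> that exists at all can be made homogeneous: replace each entry by its component of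
the required degree. Since \<open>A\<close> is homogeneous, this takes the product \<open>A * Y = B\<close> to the corresponding
components of \<open>B\<close>, that is, to \<open>B\<close>.\<close>

lemma graded_mat_lift:
  assumes A: "graded_mat r s A" and B: "graded_mat r c B"
    and im: "\<And>j. j < length c \<Longrightarrow> col B j \<in> mat_image A"
  shows "\<exists>X. graded_mat s c X \<and> A * X = B"
proof -
  note Ac = graded_mat_carrier[OF A] and Bc = graded_mat_carrier[OF B]
  obtain Y where Y: "Y \<in> carrier_mat (length s) (length c)" "A * Y = B"
    using mat_lift[OF Ac Bc im] by blast
  define X where "X = mat (length s) (length c) (\<lambda>(j, l). hom_component (c ! l - s ! j) (Y $$ (j, l)))"
  have Xc: "X \<in> carrier_mat (length s) (length c)" by (simp add: X_def)
  have "graded_mat s c X"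
    by (simp add: graded_mat_def X_def homogeneous_hom_component)
  moreover have "A * X = B"
  proof (rule eq_matI)
    fix k l assume "k < dim_row B" "l < dim_col B"
    then have kl: "k < length r" "l < length c" using Bc by auto
    have "(A * X) $$ (k, l) = (\<Sum>j<length s. A $$ (k, j) * X $$ (j, l))"
      using kl Ac Xc by (auto simp: scalar_prod_def atLeast0LessThan intro!: sum.cong)
    also have "\<dots> = (\<Sum>j<length s. hom_component (c ! l - r ! k) (A $$ (k, j) * Y $$ (j, l)))"
    proof (rule sum.cong[OF refl])
      fix j assume j: "j \<in> {..<length s}"
      have "homogeneous (s ! j - r ! k) (A $$ (k, j))"
        using A j kl by (auto simp: graded_mat_def)
      from hom_component_mult[OF this, of "c ! l - s ! j" "Y $$ (j, l)"]
      show "A $$ (k, j) * X $$ (j, l) = hom_component (c ! l - r ! k) (A $$ (k, j) * Y $$ (j, l))"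
        using j kl by (simp add: X_def algebra_simps)
    qed
    also have "\<dots> = hom_component (c ! l - r ! k) ((A * Y) $$ (k, l))"
      unfolding hom_component_sum[symmetric]
      using kl Ac Y(1) by (auto simp: scalar_prod_def atLeast0LessThan intro!: sum.cong arg_cong[of _ _ "hom_component _"])
    also have "\<dots> = B $$ (k, l)"
      unfolding Y(2) using B kl by (intro hom_component_homogeneous) (auto simp: graded_mat_def)
    finally show "(A * X) $$ (k, l) = B $$ (k, l)" .
  qed (use Ac Bc Xc in auto)
  ultimately show ?thesis by blast
qed

lemma homogeneous_sum: "(\<And>a. a \<in> A \<Longrightarrow> homogeneous d (f a)) \<Longrightarrow> homogeneous d (sum f A)"
  by (induction A rule: infinite_finite_induct) (auto simp: homogeneous_add)

lemma graded_mat_mult: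
  assumes A: "graded_mat r s A" and B: "graded_mat s c B"
  shows "graded_mat r c (A * B)"
proof -
  note Ac = graded_mat_carrier[OF A] and Bc = graded_mat_carrier[OF B]
  have "homogeneous (c ! l - r ! k) ((A * B) $$ (k, l))" if kl: "k < length r" "l < length c" for k l
  proof -
    have "(A * B) $$ (k, l) = (\<Sum>j<length s. A $$ (k, j) * B $$ (j, l))"
      using kl Ac Bc by (auto simp: scalar_prod_def atLeast0LessThan intro!: sum.cong)
    moreover have "homogeneous (c ! l - r ! k) (A $$ (k, j) * B $$ (j, l))" if "j < length s" for j
      using homogeneous_mult[of "s ! j - r ! k" "A $$ (k, j)" "c ! l - s ! j" "B $$ (j, l)"] A B kl that
      by (simp add: graded_mat_def)
    ultimately show ?thesis by (auto intro: homogeneous_sum)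
  qed
  then show ?thesis using Ac Bc by (simp add: graded_mat_def)
qed

section \<open>Comparison maps\<close>

context
  fixes I :: "('v::finite, 'k::field) polyring set" and F
  assumes res: "graded_free_resolution I F"
begin

lemma resolution_graded_mat: "graded_mat (shifts F i) (shifts F (Suc i)) (boundary F i)"
  using res by (auto simp: graded_free_resolution_def graded_free_complex_def graded_mat_def free_rank_def)

lemma resolution_carrier: "boundary F i \<in> carrier_mat (free_rank F i) (free_rank F (Suc i))"
  using res by (auto simp: graded_free_resolution_def graded_free_complex_def)

lemma resolution_augmentation_carrier: "augmentation F \<in> carrier_vec (free_rank F 0)"
  using res by (auto simp: graded_free_resolution_def graded_free_complex_def)

lemma resolution_surj: "\<exists>v \<in> carrier_vec (free_rank F 0). p - augmentation F \<bullet> v \<in> I"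
  using res by (auto simp: graded_free_resolution_def)

lemma resolution_augmentation_exact:
  "v \<in> carrier_vec (free_rank F 0) \<Longrightarrow> augmentation F \<bullet> v \<in> I \<longleftrightarrow> v \<in> mat_image (boundary F 0)"
  using res by (auto simp: graded_free_resolution_def)

lemma resolution_exact:
  "v \<in> carrier_vec (free_rank F (Suc i)) \<Longrightarrow>
     boundary F i *\<^sub>v v = 0\<^sub>v (free_rank F i) \<longleftrightarrow> v \<in> mat_image (boundary F (Suc i))"
  using res by (auto simp: graded_free_resolution_def)

lemma resolution_mat_imageI:
  "u \<in> carrier_vec (free_rank F (Suc i)) \<Longrightarrow> boundary F i *\<^sub>v u \<in> mat_image (boundary F i)"
  using mat_image_iff[OF resolution_carrier] by blast

lemma resolution_image_carrier:
  "u \<in> carrier_vec (free_rank F (Suc i)) \<Longrightarrow> boundary F i *\<^sub>v u \<in> carrier_vec (free_rank F i)"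
  using resolution_carrier mult_mat_vec_carrier by blast

lemma resolution_boundary_boundary:
  assumes "u \<in> carrier_vec (free_rank F (Suc (Suc i)))"
  shows "boundary F i *\<^sub>v (boundary F (Suc i) *\<^sub>v u) = 0\<^sub>v (free_rank F i)"
  using resolution_exact[OF resolution_image_carrier[OF assms]] resolution_mat_imageI[OF assms] by blast

lemma resolution_boundary_mult:
  "boundary F i * boundary F (Suc i) = 0\<^sub>m (free_rank F i) (free_rank F (Suc (Suc i)))"
proof (rule mat_col_eqI)
  fix j assume "j < dim_col (0\<^sub>m (free_rank F i) (free_rank F (Suc (Suc i))) :: ('v, 'k) polyring mat)"
  then have j: "j < free_rank F (Suc (Suc i))" by simp
  have "col (boundary F i * boundary F (Suc i)) j =
      boundary F i *\<^sub>v (boundary F (Suc i) *\<^sub>v unit_vec (free_rank F (Suc (Suc i))) j)"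
    using j by (simp add: col_mult2[OF resolution_carrier resolution_carrier]
        mult_mat_unit_vec[OF resolution_carrier])
  also have "\<dots> = 0\<^sub>v (free_rank F i)" by (rule resolution_boundary_boundary) simp
  finally show "col (boundary F i * boundary F (Suc i)) j =
      col (0\<^sub>m (free_rank F i) (free_rank F (Suc (Suc i)))) j" using j by simp
qed (use resolution_carrier[of i] resolution_carrier[of "Suc i"] in auto)

lemma resolution_lift:
  assumes "M \<in> carrier_mat (free_rank F (Suc i)) l" "boundary F i * M = 0\<^sub>m (free_rank F i) l"
  shows "\<exists>X\<in>carrier_mat (free_rank F (Suc (Suc i))) l. boundary F (Suc i) * X = M"
proof (rule mat_lift[OF resolution_carrier assms(1)])
  fix j assume j: "j < l"
  have "boundary F i *\<^sub>v col M j = col (boundary F i * M) j"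
    using j by (simp add: col_mult2[OF resolution_carrier assms(1)])
  also have "\<dots> = 0\<^sub>v (free_rank F i)" using j by (simp add: assms(2))
  finally show "col M j \<in> mat_image (boundary F (Suc i))"
    using resolution_exact[of "col M j"] assms(1) j by auto
qed

end

text \<open>The family \<open>\<psi>\<close> is a chain map from the resolution \<open>G\<close>, with degrees shifted by \<open>d\<close>, to \<open>F\<close> that induces
multiplication by \<open>f\<close> on the resolved quotient rings. With \<open>f = 1\<close> and \<open>d = 0\<close> these are the usual comparison maps.\<close>

definition lifts_mult where
  "lifts_mult I f d F G \<psi> \<longleftrightarrow>
     (\<forall>i. graded_mat (shifts F i) (map ((+) d) (shifts G i)) (\<psi> i) \<and>
          boundary F i * \<psi> (Suc i) = \<psi> i * boundary G i) \<and>
     (\<forall>u\<in>carrier_vec (free_rank G 0). augmentation F \<bullet> (\<psi> 0 *\<^sub>v u) - f * (augmentation G \<bullet> u) \<in> I)"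

lemma scalar_prod_in_ideal:
  assumes "homogeneous_ideal I" "u \<in> carrier_vec n" "\<And>j. j < n \<Longrightarrow> a $ j \<in> I"
  shows "a \<bullet> u \<in> I"
  unfolding scalar_prod_def
proof (rule homogeneous_ideal_sum[OF assms(1)])
  fix j assume "j \<in> {0..<dim_vec u}"
  then have "u $ j * a $ j \<in> I"
    using assms by (intro homogeneous_ideal_mult[OF assms(1)]) auto
  then show "a $ j * u $ j \<in> I" by (simp add: mult.commute)
qed

lemma graded_mat_shift: "graded_mat r s A \<Longrightarrow> graded_mat (map ((+) d) r) (map ((+) d) s) A"
  by (simp add: graded_mat_def)

text \<open>The comparison theorem for projective resolutions, in graded form. The maps are chosen one degree after the
other; the next one exists because the composite of the last one with the boundary of \<open>G\<close> lands in the
image of the boundary of \<open>F\<close>, so this property is carried along in the construction.\<close>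

lemma comparison_maps:
  fixes I :: "('v::finite, 'k::field) polyring set"
  assumes I: "homogeneous_ideal I"
    and F: "graded_free_resolution I F" and G: "graded_free_resolution K G"
    and g: "homogeneous d g" and K: "\<And>p. p \<in> K \<Longrightarrow> g * p \<in> I"
  shows "\<exists>\<phi>. lifts_mult I g d F G \<phi>"
proof -
  let ?aug = "\<lambda>M. \<forall>u\<in>carrier_vec (free_rank G 0).
      augmentation F \<bullet> (M *\<^sub>v u) - g * (augmentation G \<bullet> u) \<in> I"
  define P where "P i M \<longleftrightarrow> graded_mat (shifts F i) (map ((+) d) (shifts G i)) M \<and>
      (\<forall>u\<in>carrier_vec (free_rank G (Suc i)). M *\<^sub>v (boundary G i *\<^sub>v u) \<in> mat_image (boundary F i)) \<and>
      (i = 0 \<longrightarrow> ?aug M)" for i M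
  define Q where "Q i M N \<longleftrightarrow> boundary F i * N = M * boundary G i" for i M N
  have cF: "length (shifts F i) = free_rank F i" and cG: "length (shifts G i) = free_rank G i" for i
    by (simp_all add: free_rank_def)
  note dF = resolution_carrier[OF F] and dG = resolution_carrier[OF G]
  have "\<exists>\<phi>. \<forall>i. P i (\<phi> i) \<and> Q i (\<phi> i) (\<phi> (Suc i))"
  proof (rule dependent_nat_choice)
    have "\<exists>w. \<forall>l. w l \<in> carrier_vec (free_rank F 0) \<and> g * augmentation G $ l - augmentation F \<bullet> w l \<in> I"
      using resolution_surj[OF F] by (intro choice) blast
    then obtain w where w: "\<And>l. w l \<in> carrier_vec (free_rank F 0)"
      "\<And>l. g * augmentation G $ l - augmentation F \<bullet> w l \<in> I"
      by blast
    \<comment> \<open>representatives \<open>w l\<close> of the products with the basis images, cut down to the right degrees\<close>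
    define M where "M = mat (free_rank F 0) (free_rank G 0)
      (\<lambda>(k, l). hom_component (d + shifts G 0 ! l - shifts F 0 ! k) (w l $ k))"
    have Mc: "M \<in> carrier_mat (free_rank F 0) (free_rank G 0)" by (simp add: M_def)
    have gr: "graded_mat (shifts F 0) (map ((+) d) (shifts G 0)) M"
      by (simp add: graded_mat_def M_def homogeneous_hom_component cF cG)
    have col: "augmentation F \<bullet> col M l - g * augmentation G $ l \<in> I" if l: "l < free_rank G 0" for l
    proof -
      let ?e = "d + shifts G 0 ! l"
      have "augmentation F \<bullet> col M l = (\<Sum>k<free_rank F 0. augmentation F $ k * M $$ (k, l))"
        using l Mc by (auto simp: scalar_prod_def atLeast0LessThan intro!: sum.cong)
      also have "\<dots> = (\<Sum>k<free_rank F 0. hom_component ?e (augmentation F $ k * w l $ k))"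
      proof (rule sum.cong[OF refl])
        fix k assume k: "k \<in> {..<free_rank F 0}"
        have "homogeneous (shifts F 0 ! k) (augmentation F $ k)"
          using F k by (auto simp: graded_free_resolution_def graded_free_complex_def)
        from hom_component_mult[OF this, of "?e - shifts F 0 ! k" "w l $ k"]
        show "augmentation F $ k * M $$ (k, l) = hom_component ?e (augmentation F $ k * w l $ k)"
          using k l by (simp add: M_def)
      qed
      also have "\<dots> = hom_component ?e (augmentation F \<bullet> w l)"
        unfolding hom_component_sum[symmetric] using w(1)[of l]
        by (auto simp: scalar_prod_def atLeast0LessThan)
      finally have 1: "augmentation F \<bullet> col M l = hom_component ?e (augmentation F \<bullet> w l)" .
      have "homogeneous (shifts G 0 ! l) (augmentation G $ l)"
        using G l by (auto simp: graded_free_resolution_def graded_free_complex_def)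
      then have 2: "g * augmentation G $ l = hom_component ?e (g * augmentation G $ l)"
        by (intro hom_component_homogeneous[symmetric] homogeneous_mult g)
      have "hom_component ?e (augmentation F \<bullet> w l - g * augmentation G $ l) \<in> I"
        using homogeneous_ideal_minus[OF I homogeneous_ideal_0[OF I] w(2)[of l]]
        by (intro homogeneous_ideal_component[OF I]) simp
      then show ?thesis unfolding 1 by (subst 2) (simp add: hom_component_minus)
    qed
    have aug: "?aug M"
    proof
      fix u :: "('v, 'k) polyring vec" assume u: "u \<in> carrier_vec (free_rank G 0)"
      note aF = resolution_augmentation_carrier[OF F] and aG = resolution_augmentation_carrier[OF G]
      have "augmentation F \<bullet> (M *\<^sub>v u) - g * (augmentation G \<bullet> u) =
          (transpose_mat M *\<^sub>v augmentation F - g \<cdot>\<^sub>v augmentation G) \<bullet> u"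
        using u aF aG Mc
        by (simp add: transpose_vec_mult_scalar[OF Mc u aF, symmetric] minus_scalar_prod_distrib[of _ "free_rank G 0"])
      also have "\<dots> \<in> I"
      proof (rule scalar_prod_in_ideal[OF I u])
        fix j assume j: "j < free_rank G 0"
        have "col M j \<bullet> augmentation F = augmentation F \<bullet> col M j"
          using Mc aF j by (intro comm_scalar_prod) auto
        then show "(transpose_mat M *\<^sub>v augmentation F - g \<cdot>\<^sub>v augmentation G) $ j \<in> I"
          using col[OF j] j Mc aG by simp
      qed
      finally show "augmentation F \<bullet> (M *\<^sub>v u) - g * (augmentation G \<bullet> u) \<in> I" .
    qed
    have "M *\<^sub>v (boundary G 0 *\<^sub>v u) \<in> mat_image (boundary F 0)"
      if u: "u \<in> carrier_vec (free_rank G (Suc 0))" for u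
    proof -
      let ?v = "boundary G 0 *\<^sub>v u"
      have v: "?v \<in> carrier_vec (free_rank G 0)" by (rule resolution_image_carrier[OF G u])
      have "augmentation G \<bullet> ?v \<in> K"
        using resolution_augmentation_exact[OF G v] resolution_mat_imageI[OF G u] by simp
      then have "g * (augmentation G \<bullet> ?v) \<in> I" by (rule K)
      then have "(augmentation F \<bullet> (M *\<^sub>v ?v) - g * (augmentation G \<bullet> ?v)) + g * (augmentation G \<bullet> ?v) \<in> I"
        using aug v by (intro homogeneous_ideal_add[OF I]) auto
      then show ?thesis
        using resolution_augmentation_exact[OF F mult_mat_vec_carrier[OF Mc v]] by simp
    qed
    then show "\<exists>M. P 0 M" using gr aug unfolding P_def by blast
  next
    \<comment> \<open>the columns of \<open>M\<close> times the boundary of \<open>G\<close> can be lifted through the boundary of \<open>F\<close>\<close>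
    fix M i assume P: "P i M"
    then have gr: "graded_mat (shifts F i) (map ((+) d) (shifts G i)) M" by (simp add: P_def)
    have Mc: "M \<in> carrier_mat (free_rank F i) (free_rank G i)"
      using graded_mat_carrier[OF gr] by (simp add: free_rank_def)
    have "\<exists>N. graded_mat (shifts F (Suc i)) (map ((+) d) (shifts G (Suc i))) N \<and>
        boundary F i * N = M * boundary G i"
    proof (rule graded_mat_lift[OF resolution_graded_mat[OF F]])
      show "graded_mat (shifts F i) (map ((+) d) (shifts G (Suc i))) (M * boundary G i)"
        by (rule graded_mat_mult[OF gr graded_mat_shift[OF resolution_graded_mat[OF G]]])
      fix j assume "j < length (map ((+) d) (shifts G (Suc i)))"
      then have j: "j < free_rank G (Suc i)" by (simp add: free_rank_def)
      have "col (M * boundary G i) j = M *\<^sub>v (boundary G i *\<^sub>v unit_vec (free_rank G (Suc i)) j)"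
        using j by (simp add: col_mult2[OF Mc dG] mult_mat_unit_vec[OF dG])
      then show "col (M * boundary G i) j \<in> mat_image (boundary F i)"
        using P unfolding P_def by simp
    qed
    then obtain N where N: "graded_mat (shifts F (Suc i)) (map ((+) d) (shifts G (Suc i))) N"
      "boundary F i * N = M * boundary G i" by blast
    have Nc: "N \<in> carrier_mat (free_rank F (Suc i)) (free_rank G (Suc i))"
      using graded_mat_carrier[OF N(1)] by (simp add: free_rank_def)
    have "N *\<^sub>v (boundary G (Suc i) *\<^sub>v u) \<in> mat_image (boundary F (Suc i))"
      if u: "u \<in> carrier_vec (free_rank G (Suc (Suc i)))" for u
    proof -
      let ?v = "boundary G (Suc i) *\<^sub>v u"
      have v: "?v \<in> carrier_vec (free_rank G (Suc i))" by (rule resolution_image_carrier[OF G u])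
      have "boundary F i *\<^sub>v (N *\<^sub>v ?v) = M *\<^sub>v (boundary G i *\<^sub>v ?v)"
        using assoc_mult_mat_vec[OF dF Nc v] assoc_mult_mat_vec[OF Mc dG v] N(2) by simp
      also have "\<dots> = 0\<^sub>v (free_rank F i)"
        by (simp add: resolution_boundary_boundary[OF G u] mult_mat_zero_vec[OF Mc])
      finally show ?thesis
        using resolution_exact[OF F mult_mat_vec_carrier[OF Nc v]] by simp
    qed
    then show "\<exists>N. P (Suc i) N \<and> Q i M N" using N unfolding P_def Q_def by blast
  qed
  then show ?thesis unfolding P_def Q_def lifts_mult_def by blast
qed

section \<open>Mapping cones\<close>

text \<open>The summand of the cone that comes from \<open>G\<close> is \<open>G\<close> moved up by one position, with zero in position 0.
Treating position 0 as a module of rank 0 lets all boundary maps of the cone have the same block form.\<close>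

definition shifted_rank :: "('v::finite, 'k::field) polyring free_complex \<Rightarrow> nat \<Rightarrow> nat" where
  "shifted_rank G i = (case i of 0 \<Rightarrow> 0 | Suc j \<Rightarrow> free_rank G j)"

definition shifted_boundary ::
  "('v::finite, 'k::field) polyring free_complex \<Rightarrow> nat \<Rightarrow> ('v, 'k) polyring mat" where
  "shifted_boundary G i = (case i of 0 \<Rightarrow> 0\<^sub>m 0 (free_rank G 0) | Suc j \<Rightarrow> - boundary G j)"

definition mapping_cone ::
  "int \<Rightarrow> ('v::finite, 'k::field) polyring free_complex \<Rightarrow> ('v, 'k) polyring free_complex \<Rightarrow>
    (nat \<Rightarrow> ('v, 'k) polyring mat) \<Rightarrow> ('v, 'k) polyring free_complex" where
  "mapping_cone d F G \<psi> =
     \<lparr>shifts = \<lambda>i. shifts F i @ (case i of 0 \<Rightarrow> [] | Suc j \<Rightarrow> map ((+) d) (shifts G j)),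
      augmentation = augmentation F,
      boundary = \<lambda>i. four_block_mat (boundary F i) (\<psi> i)
        (0\<^sub>m (shifted_rank G i) (free_rank F (Suc i))) (shifted_boundary G i)\<rparr>"

lemma free_rank_mapping_cone: "free_rank (mapping_cone d F G \<psi>) i = free_rank F i + shifted_rank G i"
  by (simp add: free_rank_def mapping_cone_def shifted_rank_def split: nat.split)

lemma mult_mat_uminus_vec:
  assumes "(A :: 'a::comm_ring_1 mat) \<in> carrier_mat n m" "v \<in> carrier_vec m"
  shows "A *\<^sub>v (- v) = - (A *\<^sub>v v)"
  using assms by (intro eq_vecI) (auto simp: scalar_prod_def sum_negf)

lemma append_vec_eq_iff:
  assumes "a \<in> carrier_vec n" "a' \<in> carrier_vec n"
  shows "a @\<^sub>v b = a' @\<^sub>v b' \<longleftrightarrow> a = a' \<and> b = b'"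
  using append_vec_eq[OF assms] by blast

context
  fixes I K :: "('v::finite, 'k::field) polyring set" and F G \<psi> f d
  assumes I: "homogeneous_ideal I"
    and F: "graded_free_resolution I F" and G: "graded_free_resolution K G"
    and f: "homogeneous d f" and K: "K = {p. f * p \<in> I}"
    and \<psi>: "lifts_mult I f d F G \<psi>"
begin

lemma cone_map_carrier: "\<psi> i \<in> carrier_mat (free_rank F i) (free_rank G i)"
  using \<psi> graded_mat_carrier unfolding lifts_mult_def by (fastforce simp: free_rank_def)

lemma shifted_boundary_carrier:
  "shifted_boundary G i \<in> carrier_mat (shifted_rank G i) (free_rank G i)"
  using resolution_carrier[OF G] by (auto simp: shifted_boundary_def shifted_rank_def split: nat.split)

lemma cone_boundary_carrier:
  "boundary (mapping_cone d F G \<psi>) i \<in>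
     carrier_mat (free_rank F i + shifted_rank G i) (free_rank F (Suc i) + free_rank G i)"
  using four_block_carrier_mat[OF resolution_carrier[OF F] shifted_boundary_carrier]
  by (simp add: mapping_cone_def)

lemma cone_boundary_mult:
  assumes "w \<in> carrier_vec (free_rank F (Suc i))" "u \<in> carrier_vec (free_rank G i)"
  shows "boundary (mapping_cone d F G \<psi>) i *\<^sub>v (w @\<^sub>v u) =
    (boundary F i *\<^sub>v w + \<psi> i *\<^sub>v u) @\<^sub>v (shifted_boundary G i *\<^sub>v u)"
proof -
  have "0\<^sub>m (shifted_rank G i) (free_rank F (Suc i)) *\<^sub>v w + shifted_boundary G i *\<^sub>v u =
      shifted_boundary G i *\<^sub>v u"
    using assms shifted_boundary_carrier[of i] by (intro eq_vecI) auto
  then show ?thesis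
    using four_block_mat_mult_vec[OF resolution_carrier[OF F] cone_map_carrier
        zero_carrier_mat shifted_boundary_carrier assms]
    by (simp add: mapping_cone_def)
qed

lemma cone_vec_cases:
  assumes "v \<in> carrier_vec (free_rank (mapping_cone d F G \<psi>) (Suc i))"
  obtains w u where "w \<in> carrier_vec (free_rank F (Suc i))" "u \<in> carrier_vec (free_rank G i)"
    "v = w @\<^sub>v u"
  using that[of "vec_first v (free_rank F (Suc i))" "vec_last v (free_rank G i)"] assms
  by (simp add: free_rank_mapping_cone shifted_rank_def)

lemma cone_image_iff:
  "v \<in> mat_image (boundary (mapping_cone d F G \<psi>) i) \<longleftrightarrow>
     (\<exists>w\<in>carrier_vec (free_rank F (Suc i)). \<exists>u\<in>carrier_vec (free_rank G i).
        v = (boundary F i *\<^sub>v w + \<psi> i *\<^sub>v u) @\<^sub>v (shifted_boundary G i *\<^sub>v u))"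
proof -
  have "v \<in> mat_image (boundary (mapping_cone d F G \<psi>) i) \<longleftrightarrow>
      (\<exists>z\<in>carrier_vec (free_rank (mapping_cone d F G \<psi>) (Suc i)).
         v = boundary (mapping_cone d F G \<psi>) i *\<^sub>v z)"
    using mat_image_iff[OF cone_boundary_carrier, of v i]
    by (simp add: free_rank_mapping_cone shifted_rank_def)
  also have "\<dots> \<longleftrightarrow> (\<exists>w\<in>carrier_vec (free_rank F (Suc i)). \<exists>u\<in>carrier_vec (free_rank G i).
         v = boundary (mapping_cone d F G \<psi>) i *\<^sub>v (w @\<^sub>v u))"
  proof
    assume "\<exists>z\<in>carrier_vec (free_rank (mapping_cone d F G \<psi>) (Suc i)).
         v = boundary (mapping_cone d F G \<psi>) i *\<^sub>v z"
    then show "\<exists>w\<in>carrier_vec (free_rank F (Suc i)). \<exists>u\<in>carrier_vec (free_rank G i).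
         v = boundary (mapping_cone d F G \<psi>) i *\<^sub>v (w @\<^sub>v u)"
      by (metis cone_vec_cases)
  next
    assume "\<exists>w\<in>carrier_vec (free_rank F (Suc i)). \<exists>u\<in>carrier_vec (free_rank G i).
         v = boundary (mapping_cone d F G \<psi>) i *\<^sub>v (w @\<^sub>v u)"
    then obtain w u where "w \<in> carrier_vec (free_rank F (Suc i))" "u \<in> carrier_vec (free_rank G i)"
         "v = boundary (mapping_cone d F G \<psi>) i *\<^sub>v (w @\<^sub>v u)" by blast
    then show "\<exists>z\<in>carrier_vec (free_rank (mapping_cone d F G \<psi>) (Suc i)).
         v = boundary (mapping_cone d F G \<psi>) i *\<^sub>v z"
      by (intro bexI[of _ "w @\<^sub>v u"]) (auto simp: free_rank_mapping_cone shifted_rank_def)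
  qed
  also have "\<dots> \<longleftrightarrow> (\<exists>w\<in>carrier_vec (free_rank F (Suc i)). \<exists>u\<in>carrier_vec (free_rank G i).
        v = (boundary F i *\<^sub>v w + \<psi> i *\<^sub>v u) @\<^sub>v (shifted_boundary G i *\<^sub>v u))"
    by (intro bex_cong refl) (simp add: cone_boundary_mult)
  finally show ?thesis .
qed

lemma cone_map_comm:
  assumes "u \<in> carrier_vec (free_rank G (Suc i))"
  shows "boundary F i *\<^sub>v (\<psi> (Suc i) *\<^sub>v u) = \<psi> i *\<^sub>v (boundary G i *\<^sub>v u)"
  using \<psi> unfolding lifts_mult_def
  by (metis assms assoc_mult_mat_vec cone_map_carrier resolution_carrier[OF F] resolution_carrier[OF G])

lemma cone_map_augmentation:
  "u \<in> carrier_vec (free_rank G 0) \<Longrightarrow>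
     augmentation F \<bullet> (\<psi> 0 *\<^sub>v u) - f * (augmentation G \<bullet> u) \<in> I"
  using \<psi> unfolding lifts_mult_def by blast

lemma cone_graded: "graded_free_complex (mapping_cone d F G \<psi>)"
proof -
  let ?C = "mapping_cone d F G \<psi>"
  have "homogeneous (shifts ?C (Suc i) ! l - shifts ?C i ! k) (boundary ?C i $$ (k, l))"
    if k: "k < free_rank ?C i" and l: "l < free_rank ?C (Suc i)" for i k l
  proof -
    have k': "k < free_rank F i + shifted_rank G i" and l': "l < free_rank F (Suc i) + free_rank G i"
      using k l by (simp_all add: free_rank_mapping_cone shifted_rank_def)
    have dims: "dim_row (boundary F i) = free_rank F i" "dim_col (boundary F i) = free_rank F (Suc i)"
      "dim_row (shifted_boundary G i) = shifted_rank G i" "dim_col (shifted_boundary G i) = free_rank G i"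
      using resolution_carrier[OF F, of i] shifted_boundary_carrier[of i] by auto
    have gF: "graded_mat (shifts F i) (shifts F (Suc i)) (boundary F i)"
      by (rule resolution_graded_mat[OF F])
    have g\<psi>: "graded_mat (shifts F i) (map ((+) d) (shifts G i)) (\<psi> i)"
      using \<psi> unfolding lifts_mult_def by blast
    have s: "shifts ?C (Suc i) ! l = (if l < free_rank F (Suc i) then shifts F (Suc i) ! l
        else d + shifts G i ! (l - free_rank F (Suc i)))"
      using l' by (auto simp: mapping_cone_def nth_append free_rank_def)
    have b: "boundary ?C i $$ (k, l) = (if k < free_rank F i
        then if l < free_rank F (Suc i) then boundary F i $$ (k, l) else \<psi> i $$ (k, l - free_rank F (Suc i))
        else if l < free_rank F (Suc i) then 0
        else shifted_boundary G i $$ (k - free_rank F i, l - free_rank F (Suc i)))"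
      using k' l' by (auto simp: mapping_cone_def dims)
    show ?thesis
    proof (cases "k < free_rank F i")
      case True
      then have "shifts ?C i ! k = shifts F i ! k"
        by (auto simp: mapping_cone_def nth_append free_rank_def)
      then show ?thesis
        using True l' gF g\<psi> unfolding s b by (auto simp: graded_mat_def free_rank_def)
    next
      case False
      then obtain j where j: "i = Suc j" using k' by (cases i) (auto simp: shifted_rank_def)
      have "shifts ?C i ! k = d + shifts G j ! (k - free_rank F i)"
        using False k' j by (auto simp: mapping_cone_def nth_append free_rank_def shifted_rank_def)
      moreover have "graded_mat (shifts G j) (shifts G (Suc j)) (boundary G j)"
        by (rule resolution_graded_mat[OF G])
      ultimately show ?thesis
        using False l' k' j resolution_carrier[OF G, of j] unfolding s b
        by (auto simp: graded_mat_def free_rank_def shifted_rank_def shifted_boundary_def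
            intro!: homogeneous_uminus)
    qed
  qed
  moreover have "boundary ?C i \<in> carrier_mat (free_rank ?C i) (free_rank ?C (Suc i))" for i
    using cone_boundary_carrier[of i] by (simp add: free_rank_mapping_cone shifted_rank_def)
  moreover have "free_rank ?C 0 = free_rank F 0"
    by (simp add: free_rank_mapping_cone shifted_rank_def)
  moreover have "augmentation ?C = augmentation F" "shifts ?C 0 = shifts F 0"
    by (simp_all add: mapping_cone_def)
  moreover have "graded_free_complex F" using F by (simp add: graded_free_resolution_def)
  ultimately show ?thesis unfolding graded_free_complex_def by auto
qed

text \<open>The long exact sequence of the cone, written out on elements. The one place where the shape of \<open>K\<close> matters
is at \<open>F\<^sub>1 \<oplus> G\<^sub>0\<close>: a cycle there has its second component \<open>u\<close> with \<open>f\<close> times the augmentation of \<open>u\<close> in \<open>I\<close>,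
and this says that \<open>u\<close> is a boundary of \<open>G\<close> exactly because \<open>K\<close> is the whole colon ideal.\<close>

lemma cone_resolution:
  "graded_free_resolution {a + c * f | a c. a \<in> I} (mapping_cone d F G \<psi>)"
proof -
  let ?C = "mapping_cone d F G \<psi>" and ?J = "{a + c * f | a c. a \<in> I}"
  have "free_rank ?C 0 = free_rank F 0"
    by (simp add: free_rank_mapping_cone shifted_rank_def)
  moreover have "augmentation ?C = augmentation F"
    by (simp add: mapping_cone_def)
  ultimately have C0: "free_rank ?C 0 = free_rank F 0" "augmentation ?C = augmentation F" .
  note aF = resolution_augmentation_carrier[OF F] and aG = resolution_augmentation_carrier[OF G]
  note dF = resolution_carrier[OF F] and dG = resolution_carrier[OF G]
  have IJ: "I \<subseteq> ?J"
  proof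
    fix a assume "a \<in> I"
    then show "a \<in> ?J" by (intro CollectI exI[of _ a] exI[of _ 0]) simp
  qed
  have surj: "\<exists>v\<in>carrier_vec (free_rank ?C 0). p - augmentation ?C \<bullet> v \<in> ?J" for p
    using resolution_surj[OF F, of p] IJ unfolding C0 by blast
  have add: "augmentation F \<bullet> (a + b) = augmentation F \<bullet> a + augmentation F \<bullet> b"
    if "a \<in> carrier_vec (free_rank F 0)" "b \<in> carrier_vec (free_rank F 0)" for a b
    using scalar_prod_add_distrib[OF aF that] .
  have aug: "augmentation ?C \<bullet> v \<in> ?J \<longleftrightarrow> v \<in> mat_image (boundary ?C 0)"
    if "v \<in> carrier_vec (free_rank ?C 0)" for v
  proof
    have v: "v \<in> carrier_vec (free_rank F 0)" using that by (simp add: C0)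
    assume "augmentation ?C \<bullet> v \<in> ?J"
    then obtain a c where ac: "augmentation F \<bullet> v = a + c * f" "a \<in> I" unfolding C0 by blast
    obtain u where u: "u \<in> carrier_vec (free_rank G 0)" "c - augmentation G \<bullet> u \<in> K"
      using resolution_surj[OF G] by blast
    have \<psi>u: "\<psi> 0 *\<^sub>v u \<in> carrier_vec (free_rank F 0)"
      by (rule mult_mat_vec_carrier[OF cone_map_carrier u(1)])
    have "augmentation F \<bullet> (v - \<psi> 0 *\<^sub>v u) =
        a + f * (c - augmentation G \<bullet> u) - (augmentation F \<bullet> (\<psi> 0 *\<^sub>v u) - f * (augmentation G \<bullet> u))"
      by (simp add: scalar_prod_minus_distrib[OF aF v \<psi>u] ac(1) algebra_simps)
    also have "\<dots> \<in> I"
      using u(2) K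
      by (intro homogeneous_ideal_minus[OF I _ cone_map_augmentation[OF u(1)]]
          homogeneous_ideal_add[OF I ac(2)]) simp
    finally have "v - \<psi> 0 *\<^sub>v u \<in> mat_image (boundary F 0)"
      using resolution_augmentation_exact[OF F, of "v - \<psi> 0 *\<^sub>v u"] v \<psi>u by simp
    then obtain w where w: "w \<in> carrier_vec (free_rank F (Suc 0))" "v - \<psi> 0 *\<^sub>v u = boundary F 0 *\<^sub>v w"
      using mat_image_iff[OF dF] by blast
    have "v = (boundary F 0 *\<^sub>v w + \<psi> 0 *\<^sub>v u) @\<^sub>v (shifted_boundary G 0 *\<^sub>v u)"
      unfolding w(2)[symmetric] using v \<psi>u carrier_matD[OF cone_map_carrier[of 0]]
      by (intro eq_vecI) (auto simp: shifted_boundary_def)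
    then show "v \<in> mat_image (boundary ?C 0)" using w(1) u(1) unfolding cone_image_iff by blast
  next
    assume "v \<in> mat_image (boundary ?C 0)"
    then obtain w u where wu: "w \<in> carrier_vec (free_rank F (Suc 0))" "u \<in> carrier_vec (free_rank G 0)"
      "v = (boundary F 0 *\<^sub>v w + \<psi> 0 *\<^sub>v u) @\<^sub>v (shifted_boundary G 0 *\<^sub>v u)"
      unfolding cone_image_iff by blast
    have \<psi>u: "\<psi> 0 *\<^sub>v u \<in> carrier_vec (free_rank F 0)"
      by (rule mult_mat_vec_carrier[OF cone_map_carrier wu(2)])
    have w: "boundary F 0 *\<^sub>v w \<in> carrier_vec (free_rank F 0)"
      by (rule resolution_image_carrier[OF F wu(1)])
    have v: "v = boundary F 0 *\<^sub>v w + \<psi> 0 *\<^sub>v u"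
      unfolding wu(3) using w \<psi>u by (intro eq_vecI) (auto simp: shifted_boundary_def)
    have "augmentation F \<bullet> v = (augmentation F \<bullet> (boundary F 0 *\<^sub>v w) +
        (augmentation F \<bullet> (\<psi> 0 *\<^sub>v u) - f * (augmentation G \<bullet> u))) + (augmentation G \<bullet> u) * f"
      unfolding v add[OF w \<psi>u] by (simp add: algebra_simps)
    moreover have "augmentation F \<bullet> (boundary F 0 *\<^sub>v w) \<in> I"
      using resolution_augmentation_exact[OF F w] resolution_mat_imageI[OF F wu(1)] by simp
    ultimately show "augmentation ?C \<bullet> v \<in> ?J"
      unfolding C0 using homogeneous_ideal_add[OF I _ cone_map_augmentation[OF wu(2)]] by blast
  qed
  have exact: "boundary ?C i *\<^sub>v v = 0\<^sub>v (free_rank ?C i) \<longleftrightarrow> v \<in> mat_image (boundary ?C (Suc i))"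
    if v: "v \<in> carrier_vec (free_rank ?C (Suc i))" for i v
  proof -
    obtain w u where wu: "w \<in> carrier_vec (free_rank F (Suc i))" "u \<in> carrier_vec (free_rank G i)"
      "v = w @\<^sub>v u" using cone_vec_cases[OF v] .
    have \<psi>u: "\<psi> i *\<^sub>v u \<in> carrier_vec (free_rank F i)"
      by (rule mult_mat_vec_carrier[OF cone_map_carrier wu(2)])
    have w: "boundary F i *\<^sub>v w \<in> carrier_vec (free_rank F i)"
      by (rule resolution_image_carrier[OF F wu(1)])
    have "0\<^sub>v (free_rank ?C i) = 0\<^sub>v (free_rank F i) @\<^sub>v (0\<^sub>v (shifted_rank G i) :: ('v, 'k) polyring vec)"
      by (intro eq_vecI) (auto simp: free_rank_mapping_cone)
    then have zero_iff: "boundary ?C i *\<^sub>v v = 0\<^sub>v (free_rank ?C i) \<longleftrightarrow>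
        boundary F i *\<^sub>v w + \<psi> i *\<^sub>v u = 0\<^sub>v (free_rank F i) \<and>
        shifted_boundary G i *\<^sub>v u = 0\<^sub>v (shifted_rank G i)"
      unfolding wu(3) cone_boundary_mult[OF wu(1,2)]
      using append_vec_eq_iff[of "boundary F i *\<^sub>v w + \<psi> i *\<^sub>v u" "free_rank F i"] w \<psi>u by simp
    have image_iff: "v \<in> mat_image (boundary ?C (Suc i)) \<longleftrightarrow>
      (\<exists>w'\<in>carrier_vec (free_rank F (Suc (Suc i))). \<exists>u'\<in>carrier_vec (free_rank G (Suc i)).
         w = boundary F (Suc i) *\<^sub>v w' + \<psi> (Suc i) *\<^sub>v u' \<and> u = - (boundary G i *\<^sub>v u'))"
      (is "_ \<longleftrightarrow> ?im")
      unfolding cone_image_iff wu(3)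
    proof (intro bex_cong refl)
      fix w' u' :: "('v, 'k) polyring vec"
      assume w': "w' \<in> carrier_vec (free_rank F (Suc (Suc i)))" and u': "u' \<in> carrier_vec (free_rank G (Suc i))"
      have "boundary F (Suc i) *\<^sub>v w' + \<psi> (Suc i) *\<^sub>v u' \<in> carrier_vec (free_rank F (Suc i))"
        using resolution_image_carrier[OF F w'] mult_mat_vec_carrier[OF cone_map_carrier u'] by simp
      then show "w @\<^sub>v u = (boundary F (Suc i) *\<^sub>v w' + \<psi> (Suc i) *\<^sub>v u') @\<^sub>v
           (shifted_boundary G (Suc i) *\<^sub>v u') \<longleftrightarrow>
         w = boundary F (Suc i) *\<^sub>v w' + \<psi> (Suc i) *\<^sub>v u' \<and> u = - (boundary G i *\<^sub>v u')"
        using append_vec_eq_iff[OF wu(1)] u' dG[of i] by (simp add: shifted_boundary_def)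
    qed
    show ?thesis
      unfolding zero_iff image_iff
    proof
      assume z: "boundary F i *\<^sub>v w + \<psi> i *\<^sub>v u = 0\<^sub>v (free_rank F i) \<and>
        shifted_boundary G i *\<^sub>v u = 0\<^sub>v (shifted_rank G i)"
      have "\<exists>u'\<in>carrier_vec (free_rank G (Suc i)). u = boundary G i *\<^sub>v u'"
      proof (cases i)
        case 0
        have "augmentation F \<bullet> (boundary F 0 *\<^sub>v w) + augmentation F \<bullet> (\<psi> 0 *\<^sub>v u) = 0"
          using add[of "boundary F 0 *\<^sub>v w" "\<psi> 0 *\<^sub>v u"] w \<psi>u z aF 0 by simp
        then have "f * (augmentation G \<bullet> u) = 0 - augmentation F \<bullet> (boundary F 0 *\<^sub>v w) -
            (augmentation F \<bullet> (\<psi> 0 *\<^sub>v u) - f * (augmentation G \<bullet> u))"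
          by (simp add: algebra_simps eq_neg_iff_add_eq_0)
        also have "\<dots> \<in> I"
        proof (rule homogeneous_ideal_minus[OF I homogeneous_ideal_minus[OF I homogeneous_ideal_0[OF I]]])
          show "augmentation F \<bullet> (boundary F 0 *\<^sub>v w) \<in> I"
            using resolution_augmentation_exact[OF F, of "boundary F 0 *\<^sub>v w"] w wu(1) 0
              resolution_mat_imageI[OF F, of w 0] by auto
          show "augmentation F \<bullet> (\<psi> 0 *\<^sub>v u) - f * (augmentation G \<bullet> u) \<in> I"
            using cone_map_augmentation[of u] wu(2) 0 by simp
        qed
        finally have "u \<in> mat_image (boundary G 0)"
          using resolution_augmentation_exact[OF G, of u] wu(2) 0 K by simp
        then show ?thesis using mat_image_iff[OF dG] 0 by blast
      next
        case (Suc j)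
        have "- (boundary G j *\<^sub>v u) = 0\<^sub>v (free_rank G j)"
          using z wu(2) Suc dG[of j] by (simp add: shifted_boundary_def shifted_rank_def)
        then have "boundary G j *\<^sub>v u = 0\<^sub>v (free_rank G j)"
          by (metis uminus_uminus_vec uminus_zero_vec)
        then have "u \<in> mat_image (boundary G i)"
          using resolution_exact[OF G, of u j] wu(2) Suc by simp
        then show ?thesis using mat_image_iff[OF dG] by blast
      qed
      then obtain u' where u': "u' \<in> carrier_vec (free_rank G (Suc i))" "u = boundary G i *\<^sub>v u'" by blast
      have \<psi>u': "\<psi> (Suc i) *\<^sub>v u' \<in> carrier_vec (free_rank F (Suc i))"
        by (rule mult_mat_vec_carrier[OF cone_map_carrier u'(1)])
      have "boundary F i *\<^sub>v (w + \<psi> (Suc i) *\<^sub>v u') = 0\<^sub>v (free_rank F i)"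
        using z u'(2) by (simp add: mult_add_distrib_mat_vec[OF dF wu(1) \<psi>u'] cone_map_comm[OF u'(1)])
      then have "w + \<psi> (Suc i) *\<^sub>v u' \<in> mat_image (boundary F (Suc i))"
        using resolution_exact[OF F, of "w + \<psi> (Suc i) *\<^sub>v u'" i] wu(1) \<psi>u' by simp
      then obtain w' where w': "w' \<in> carrier_vec (free_rank F (Suc (Suc i)))"
        "w + \<psi> (Suc i) *\<^sub>v u' = boundary F (Suc i) *\<^sub>v w'"
        using mat_image_iff[OF dF] by blast
      have neg: "\<psi> (Suc i) *\<^sub>v (- u') = - (\<psi> (Suc i) *\<^sub>v u')" "boundary G i *\<^sub>v (- u') = - (boundary G i *\<^sub>v u')"
        by (rule mult_mat_uminus_vec[OF cone_map_carrier u'(1)], rule mult_mat_uminus_vec[OF dG u'(1)])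
      have "w = boundary F (Suc i) *\<^sub>v w' + \<psi> (Suc i) *\<^sub>v (- u')"
        unfolding neg w'(2)[symmetric] using wu(1) \<psi>u' by (intro eq_vecI) auto
      moreover have "u = - (boundary G i *\<^sub>v (- u'))" unfolding neg u'(2) by simp
      \<comment> \<open>the sign of \<open>u'\<close> compensates the sign in the lower right block of the next boundary map\<close>
      ultimately show ?im using w'(1) u'(1) by (intro bexI[of _ w'] bexI[of _ "- u'"]) auto
    next
      assume ?im
      then obtain w' u' where w': "w' \<in> carrier_vec (free_rank F (Suc (Suc i)))"
        and u': "u' \<in> carrier_vec (free_rank G (Suc i))"
        and w_eq: "w = boundary F (Suc i) *\<^sub>v w' + \<psi> (Suc i) *\<^sub>v u'" and u_eq: "u = - (boundary G i *\<^sub>v u')"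
        by blast
      have \<psi>u': "\<psi> (Suc i) *\<^sub>v u' \<in> carrier_vec (free_rank F (Suc i))"
        by (rule mult_mat_vec_carrier[OF cone_map_carrier u'])
      have gu': "boundary G i *\<^sub>v u' \<in> carrier_vec (free_rank G i)"
        by (rule resolution_image_carrier[OF G u'])
      have neg: "\<psi> i *\<^sub>v (- (boundary G i *\<^sub>v u')) = - (\<psi> i *\<^sub>v (boundary G i *\<^sub>v u'))"
        "shifted_boundary G i *\<^sub>v (- (boundary G i *\<^sub>v u')) = - (shifted_boundary G i *\<^sub>v (boundary G i *\<^sub>v u'))"
        by (rule mult_mat_uminus_vec[OF cone_map_carrier gu'],
            rule mult_mat_uminus_vec[OF shifted_boundary_carrier gu'])
      have "boundary F i *\<^sub>v w = \<psi> i *\<^sub>v (boundary G i *\<^sub>v u')"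
        unfolding w_eq mult_add_distrib_mat_vec[OF dF resolution_image_carrier[OF F w'] \<psi>u']
          resolution_boundary_boundary[OF F w'] cone_map_comm[OF u']
        using mult_mat_vec_carrier[OF cone_map_carrier gu'] by simp
      then have "boundary F i *\<^sub>v w + \<psi> i *\<^sub>v u = 0\<^sub>v (free_rank F i)"
        unfolding u_eq neg using mult_mat_vec_carrier[OF cone_map_carrier gu'] by simp
      moreover have "shifted_boundary G i *\<^sub>v u = 0\<^sub>v (shifted_rank G i)"
      proof (cases i)
        case 0
        then show ?thesis by (intro eq_vecI) (auto simp: shifted_rank_def shifted_boundary_def)
      next
        case (Suc j)
        have "boundary G j *\<^sub>v (boundary G i *\<^sub>v u') = 0\<^sub>v (free_rank G j)"
          using resolution_boundary_boundary[OF G] u' Suc by simp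
        then show ?thesis
          using Suc gu' dG[of j] dG[of "Suc j"] unfolding u_eq neg
          by (simp add: shifted_rank_def shifted_boundary_def uminus_mult_mat_vec)
      qed
      ultimately show "boundary F i *\<^sub>v w + \<psi> i *\<^sub>v u = 0\<^sub>v (free_rank F i) \<and>
        shifted_boundary G i *\<^sub>v u = 0\<^sub>v (shifted_rank G i)" by blast
    qed
  qed
  show ?thesis
    unfolding graded_free_resolution_def using cone_graded surj aug exact by blast
qed

end

lemma smult_mat_mult_vec:
  "(A :: 'a::comm_ring_1 mat) \<in> carrier_mat n m \<Longrightarrow> v \<in> carrier_vec m \<Longrightarrow>
     (k \<cdot>\<^sub>m A) *\<^sub>v v = k \<cdot>\<^sub>v (A *\<^sub>v v)"
  by (intro eq_vecI) (auto simp: scalar_prod_def sum_distrib_left mult.assoc)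

lemma lifts_mult_smult:
  fixes I :: "('v::finite, 'k::field) polyring set"
  assumes I: "homogeneous_ideal I" and F: "graded_free_resolution I F" and G: "graded_free_resolution K G"
    and \<phi>: "lifts_mult I g d F G \<phi>" and x: "homogeneous e x"
  shows "lifts_mult I (x * g) (e + d) F G (\<lambda>i. x \<cdot>\<^sub>m \<phi> i)"
  unfolding lifts_mult_def
proof (intro conjI allI ballI)
  have gr: "graded_mat (shifts F i) (map ((+) d) (shifts G i)) (\<phi> i)" for i
    using \<phi> by (simp add: lifts_mult_def)
  have c: "\<phi> i \<in> carrier_mat (free_rank F i) (free_rank G i)" for i
    using graded_mat_carrier[OF gr[of i]] by (simp add: free_rank_def)
  fix i
  have "homogeneous ((e + d + shifts G i ! l) - shifts F i ! k) (x * \<phi> i $$ (k, l))"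
    if "k < free_rank F i" "l < free_rank G i" for k l
    using homogeneous_mult[OF x, of "(d + shifts G i ! l) - shifts F i ! k" "\<phi> i $$ (k, l)"] gr[of i] that
    by (simp add: graded_mat_def free_rank_def algebra_simps)
  then show "graded_mat (shifts F i) (map ((+) (e + d)) (shifts G i)) (x \<cdot>\<^sub>m \<phi> i)"
    using c[of i] by (simp add: graded_mat_def free_rank_def)
  have "boundary F i * \<phi> (Suc i) = \<phi> i * boundary G i" using \<phi> by (simp add: lifts_mult_def)
  then show "boundary F i * (x \<cdot>\<^sub>m \<phi> (Suc i)) = x \<cdot>\<^sub>m \<phi> i * boundary G i"
    by (simp add: mult_smult_distrib[OF resolution_carrier[OF F] c]
        mult_smult_assoc_mat[OF c resolution_carrier[OF G]])
  fix u :: "('v, 'k) polyring vec" assume u: "u \<in> carrier_vec (free_rank G 0)"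
  have "augmentation F \<bullet> ((x \<cdot>\<^sub>m \<phi> 0) *\<^sub>v u) - x * g * (augmentation G \<bullet> u) =
      x * (augmentation F \<bullet> (\<phi> 0 *\<^sub>v u) - g * (augmentation G \<bullet> u))"
    using resolution_augmentation_carrier[OF F] mult_mat_vec_carrier[OF c u]
    by (simp add: smult_mat_mult_vec[OF c u] algebra_simps)
  also have "\<dots> \<in> I"
    using \<phi> u by (intro homogeneous_ideal_mult[OF I]) (simp add: lifts_mult_def)
  finally show "augmentation F \<bullet> ((x \<cdot>\<^sub>m \<phi> 0) *\<^sub>v u) - x * g * (augmentation G \<bullet> u) \<in> I" .
qed

lemma elements_mat_subset_iff:
  assumes "A \<in> carrier_mat n m"
  shows "elements_mat A \<subseteq> S \<longleftrightarrow> (\<forall>i<n. \<forall>j<m. A $$ (i, j) \<in> S)"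
  using assms unfolding elements_mat_def by fastforce

text \<open>The nonzerodivisor \<open>x\<close> makes the colon ideals of \<open>x * g\<close> and of \<open>g\<close> equal, so multiplication by \<open>g\<close> already
induces a map of the quotient rings and lifts to some \<open>\<phi>\<close>. Then \<open>x\<close> times \<open>\<phi>\<close> lifts multiplication by
\<open>x * g\<close>, and its entries are divisible by \<open>x\<close>; this is why the cone is minimal.\<close>

lemma minimal_resolution_cone:
  fixes I :: "('v::finite, 'k::field) polyring set"
  assumes I: "homogeneous_ideal I"
    and F: "minimal_graded_free_resolution I F"
    and G: "minimal_graded_free_resolution {p. x * g * p \<in> I} G"
    and x: "homogeneous e x" "x \<in> irrelevant_ideal" and nzd: "\<And>p. x * p \<in> I \<Longrightarrow> p \<in> I"
    and g: "homogeneous d g"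
  shows "\<exists>C. minimal_graded_free_resolution {a + c * (x * g) | a c. a \<in> I} C \<and>
    (\<forall>i. free_rank C i = free_rank F i + shifted_rank G i)"
proof -
  let ?K = "{p. x * g * p \<in> I}" and ?m = "irrelevant_ideal :: ('v, 'k) polyring set"
  have rF: "graded_free_resolution I F" and rG: "graded_free_resolution ?K G"
    using F G unfolding minimal_graded_free_resolution_def by blast+
  have "\<exists>\<phi>. lifts_mult I g d F G \<phi>"
    by (rule comparison_maps[OF I rF rG g], rule nzd) (simp add: mult.assoc)
  then obtain \<phi> where \<phi>: "lifts_mult I g d F G \<phi>" by blast
  define \<psi> where "\<psi> = (\<lambda>i. x \<cdot>\<^sub>m \<phi> i)"
  have \<psi>: "lifts_mult I (x * g) (e + d) F G \<psi>"
    unfolding \<psi>_def by (rule lifts_mult_smult[OF I rF rG \<phi> x(1)])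
  let ?C = "mapping_cone (e + d) F G \<psi>"
  have xg: "homogeneous (e + d) (x * g)" by (rule homogeneous_mult[OF x(1) g])
  note cone = I rF rG xg refl \<psi>
  have mI: "homogeneous_ideal ?m" by (rule irrelevant_ideal_homogeneous)
  have "elements_mat (boundary ?C i) \<subseteq> ?m" for i
  proof -
    have 1: "elements_mat (\<psi> i) \<subseteq> ?m"
    proof
      fix p assume "p \<in> elements_mat (\<psi> i)"
      then obtain k l where "p = \<phi> i $$ (k, l) * x"
        by (auto simp: \<psi>_def mult.commute dest!: elements_matD)
      then show "p \<in> ?m" using homogeneous_ideal_mult[OF mI x(2)] by simp
    qed
    have 2: "elements_mat (boundary F i) \<subseteq> ?m"
      using F unfolding minimal_graded_free_resolution_def by blast
    have 3: "elements_mat (shifted_boundary G i) \<subseteq> ?m"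
    proof (cases i)
      case (Suc j)
      have neg: "- p \<in> ?m" if "p \<in> ?m" for p :: "('v, 'k) polyring"
        using homogeneous_ideal_minus[OF mI homogeneous_ideal_0[OF mI] that] by simp
      note dG = resolution_carrier[OF rG, of j]
      have "elements_mat (boundary G j) \<subseteq> ?m"
        using G unfolding minimal_graded_free_resolution_def by blast
      then have "boundary G j $$ (k, l) \<in> ?m" if "k < free_rank G j" "l < free_rank G (Suc j)" for k l
        using elements_mat_subset_iff[OF dG] that by blast
      then have "- boundary G j $$ (k, l) \<in> ?m" if "k < free_rank G j" "l < free_rank G (Suc j)" for k l
        using that by (intro neg)
      then have "elements_mat (- boundary G j) \<subseteq> ?m"
        using dG by (subst elements_mat_subset_iff[of _ "free_rank G j" "free_rank G (Suc j)"]) auto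
      then show ?thesis by (simp add: Suc shifted_boundary_def)
    next
      case 0
      then show ?thesis by (auto simp: shifted_boundary_def dest!: elements_matD)
    qed
    have 4: "elements_mat (0\<^sub>m (shifted_rank G i) (free_rank F (Suc i))) \<subseteq> ?m"
      using elements_0_mat homogeneous_ideal_0[OF mI] by blast
    have 5: "elements_mat (boundary ?C i) \<subseteq> elements_mat (boundary F i) \<union> elements_mat (\<psi> i) \<union>
        elements_mat (0\<^sub>m (shifted_rank G i) (free_rank F (Suc i))) \<union> elements_mat (shifted_boundary G i)"
      using elements_four_block_mat[OF resolution_carrier[OF rF] cone_map_carrier[OF cone]
          zero_carrier_mat shifted_boundary_carrier[OF cone]]
      by (simp add: mapping_cone_def)
    show ?thesis by (rule order_trans[OF 5]) (intro Un_least 1 2 3 4)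
  qed
  then have "minimal_graded_free_resolution {a + c * (x * g) | a c. a \<in> I} ?C"
    using cone_resolution[OF cone] unfolding minimal_graded_free_resolution_def by blast
  then show ?thesis by (intro exI[of _ ?C] conjI allI free_rank_mapping_cone)
qed

section \<open>Uniqueness of the ranks\<close>

text \<open>If \<open>n < m\<close>, then padding with zeros to square matrices gives a one-sided inverse, hence a two-sided one,
although the padded \<open>A\<close> has a zero row.\<close>

lemma left_inverse_imp_le:
  fixes A B :: "'k::field mat"
  assumes A: "A \<in> carrier_mat n m" and B: "B \<in> carrier_mat m n" and BA: "B * A = 1\<^sub>m m"
  shows "m \<le> n"
proof (rule ccontr)
  assume "\<not> m \<le> n"
  then have nm: "n < m" by simp
  define A' where "A' = mat m m (\<lambda>(i, j). if i < n then A $$ (i, j) else 0)"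
  define B' where "B' = mat m m (\<lambda>(i, j). if j < n then B $$ (i, j) else 0)"
  have c: "A' \<in> carrier_mat m m" "B' \<in> carrier_mat m m" by (simp_all add: A'_def B'_def)
  have "B' * A' = 1\<^sub>m m"
  proof (rule eq_matI)
    fix i j assume "i < dim_row (1\<^sub>m m :: 'k mat)" "j < dim_col (1\<^sub>m m :: 'k mat)"
    then have ij: "i < m" "j < m" by simp_all
    have "(B' * A') $$ (i, j) = (\<Sum>k<m. if k < n then B $$ (i, k) * A $$ (k, j) else 0)"
      using ij c by (auto simp: scalar_prod_def atLeast0LessThan A'_def B'_def intro!: sum.cong)
    also have "\<dots> = (\<Sum>k<n. B $$ (i, k) * A $$ (k, j))"
      using nm by (intro sum.mono_neutral_cong_right) auto
    also have "\<dots> = (B * A) $$ (i, j)"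
      using ij A B by (auto simp: scalar_prod_def atLeast0LessThan intro!: sum.cong)
    finally show "(B' * A') $$ (i, j) = 1\<^sub>m m $$ (i, j)" by (simp add: BA)
  qed (use c in auto)
  then have "A' * B' = 1\<^sub>m m" by (rule mat_mult_left_right_inverse[OF c(2,1)])
  then have "(A' * B') $$ (n, n) = 1" using nm by simp
  moreover have "(A' * B') $$ (n, n) = 0"
    using nm c by (simp add: scalar_prod_def A'_def)
  ultimately show False by simp
qed

text \<open>Reduction modulo the irrelevant ideal, as a ring homomorphism onto the field.\<close>

interpretation constant_term: comm_semiring_hom
  "\<lambda>p :: ('v, 'k::field) polyring. Poly_Mapping.lookup p 0"
  by unfold_locales (auto simp: lookup_add lookup_mult_zero)

lemma lifts_mult_carrier:
  assumes "lifts_mult I f d F G \<phi>"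
  shows "\<phi> i \<in> carrier_mat (free_rank F i) (free_rank G i)"
  using assms graded_mat_carrier unfolding lifts_mult_def by (fastforce simp: free_rank_def)

lemma elements_mat_mult_ideal:
  fixes A :: "('v::finite, 'k::field) polyring mat"
  assumes I: "homogeneous_ideal I" and A: "A \<in> carrier_mat n m" and B: "B \<in> carrier_mat m l"
    and el: "elements_mat A \<subseteq> I \<or> elements_mat B \<subseteq> I"
  shows "elements_mat (A * B) \<subseteq> I"
proof -
  have "(A * B) $$ (i, j) \<in> I" if "i < n" "j < l" for i j
  proof -
    have "(A * B) $$ (i, j) = (\<Sum>k<m. A $$ (i, k) * B $$ (k, j))"
      using that A B by (auto simp: scalar_prod_def atLeast0LessThan intro!: sum.cong)
    also have "\<dots> \<in> I"
    proof (rule homogeneous_ideal_sum[OF I])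
      fix k assume "k \<in> {..<m}"
      then have "A $$ (i, k) \<in> I \<or> B $$ (k, j) \<in> I"
        using el that A B by blast
      then show "A $$ (i, k) * B $$ (k, j) \<in> I"
        using homogeneous_ideal_mult[OF I] by (metis mult.commute)
    qed
    finally show ?thesis .
  qed
  then show ?thesis using elements_mat_subset_iff[OF mult_carrier_mat[OF A B]] by blast
qed

text \<open>A chain endomorphism of a minimal resolution that induces zero on the quotient ring is null-homotopic,
\<open>\<psi>\<^sub>i = \<partial> h\<^sub>i + h\<^sub>i\<^sub>-\<^sub>1 \<partial>\<close>, and the entries of every boundary map lie in the irrelevant ideal. The whole homotopy
need not be collected: the induction keeps, for one \<open>h\<close> at a time, that the entries of \<open>\<psi>\<^sub>i - \<partial> h\<close> lie in the
irrelevant ideal and that \<open>(\<psi>\<^sub>i - \<partial> h) \<partial> = 0\<close>, which suffices to lift to the next \<open>h\<close>.\<close>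

lemma null_homotopic_entries:
  fixes I :: "('v::finite, 'k::field) polyring set"
  assumes F: "minimal_graded_free_resolution I F"
    and c: "\<And>i. \<psi> i \<in> carrier_mat (free_rank F i) (free_rank F i)"
    and comm: "\<And>i. boundary F i * \<psi> (Suc i) = \<psi> i * boundary F i"
    and aug: "\<And>u. u \<in> carrier_vec (free_rank F 0) \<Longrightarrow> augmentation F \<bullet> (\<psi> 0 *\<^sub>v u) \<in> I"
  shows "elements_mat (\<psi> i) \<subseteq> irrelevant_ideal"
proof -
  have rF: "graded_free_resolution I F" and el: "\<And>i. elements_mat (boundary F i) \<subseteq> irrelevant_ideal"
    using F by (simp_all add: minimal_graded_free_resolution_def)
  note dF = resolution_carrier[OF rF] and m = irrelevant_ideal_homogeneous[where 'v='v and 'k='k]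
  have "\<exists>h\<in>carrier_mat (free_rank F (Suc i)) (free_rank F i).
      (\<psi> i - boundary F i * h) * boundary F i = 0\<^sub>m (free_rank F i) (free_rank F (Suc i)) \<and>
      elements_mat (\<psi> i - boundary F i * h) \<subseteq> irrelevant_ideal"
  proof (induction i)
    case 0
    have "col (\<psi> 0) j \<in> mat_image (boundary F 0)" if j: "j < free_rank F 0" for j
      using aug[of "unit_vec (free_rank F 0) j"] resolution_augmentation_exact[OF rF, of "col (\<psi> 0) j"] c[of 0] j
      by (simp add: mult_mat_unit_vec[OF c])
    then obtain h where h: "h \<in> carrier_mat (free_rank F (Suc 0)) (free_rank F 0)" "boundary F 0 * h = \<psi> 0"
      using mat_lift[OF dF c] by blast
    have z: "\<psi> 0 - boundary F 0 * h = 0\<^sub>m (free_rank F 0) (free_rank F 0)"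
      unfolding h(2) using c[of 0] by (intro eq_matI) auto
    have "elements_mat (0\<^sub>m (free_rank F 0) (free_rank F 0) :: ('v, 'k) polyring mat) \<subseteq> irrelevant_ideal"
      using elements_0_mat homogeneous_ideal_0[OF m] by blast
    then show ?case using h(1) dF[of 0] z by (intro bexI[OF _ h(1)]) simp
  next
    case (Suc i)
    then obtain h where h: "h \<in> carrier_mat (free_rank F (Suc i)) (free_rank F i)"
      and z: "(\<psi> i - boundary F i * h) * boundary F i = 0\<^sub>m (free_rank F i) (free_rank F (Suc i))"
      by blast
    let ?M = "\<psi> (Suc i) - h * boundary F i"
    have hd: "h * boundary F i \<in> carrier_mat (free_rank F (Suc i)) (free_rank F (Suc i))"
      by (rule mult_carrier_mat[OF h dF])
    have dh: "boundary F i * h \<in> carrier_mat (free_rank F i) (free_rank F i)"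
      by (rule mult_carrier_mat[OF dF h])
    have M: "?M \<in> carrier_mat (free_rank F (Suc i)) (free_rank F (Suc i))"
      by (rule minus_carrier_mat[OF hd])
    have "boundary F i * ?M = (\<psi> i - boundary F i * h) * boundary F i"
      by (simp add: mult_minus_distrib_mat[OF dF c hd] minus_mult_distrib_mat[OF c dh dF] comm
          assoc_mult_mat[OF dF h dF])
    then obtain h' where h': "h' \<in> carrier_mat (free_rank F (Suc (Suc i))) (free_rank F (Suc i))"
      "boundary F (Suc i) * h' = ?M"
      using resolution_lift[OF rF M] z by auto
    have diff: "\<psi> (Suc i) - boundary F (Suc i) * h' = h * boundary F i"
      unfolding h'(2) using c[of "Suc i"] hd by (intro eq_matI) auto
    have "h * boundary F i * boundary F (Suc i) = 0\<^sub>m (free_rank F (Suc i)) (free_rank F (Suc (Suc i)))"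
      using h by (simp add: assoc_mult_mat[OF h dF dF] resolution_boundary_mult[OF rF])
    moreover have "elements_mat (h * boundary F i) \<subseteq> irrelevant_ideal"
      using elements_mat_mult_ideal[OF m h dF] el by blast
    ultimately show ?case using h'(1) unfolding diff[symmetric] by blast
  qed
  then obtain h where h: "h \<in> carrier_mat (free_rank F (Suc i)) (free_rank F i)"
    and e: "elements_mat (\<psi> i - boundary F i * h) \<subseteq> irrelevant_ideal" by blast
  have dh: "boundary F i * h \<in> carrier_mat (free_rank F i) (free_rank F i)"
    by (rule mult_carrier_mat[OF dF h])
  have e2: "elements_mat (boundary F i * h) \<subseteq> irrelevant_ideal"
    using elements_mat_mult_ideal[OF m dF h] el by blast
  have "\<psi> i $$ (k, l) \<in> irrelevant_ideal" if kl: "k < free_rank F i" "l < free_rank F i" for k l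
  proof -
    have "(\<psi> i - boundary F i * h) $$ (k, l) \<in> irrelevant_ideal"
      using e elements_mat_subset_iff[OF minus_carrier_mat[OF dh]] kl by blast
    moreover have "(boundary F i * h) $$ (k, l) \<in> irrelevant_ideal"
      using e2 elements_mat_subset_iff[OF dh] kl by blast
    moreover have "\<psi> i $$ (k, l) = (\<psi> i - boundary F i * h) $$ (k, l) + (boundary F i * h) $$ (k, l)"
      using kl c[of i] dh by (simp del: index_mult_mat)
    ultimately show ?thesis using homogeneous_ideal_add[OF m] by metis
  qed
  then show ?thesis using elements_mat_subset_iff[OF c] by blast
qed

text \<open>The comparison maps \<open>\<alpha>\<close> and \<open>\<beta>\<close> between the resolutions compose to the identity up to homotopy, hence up to
entries in the irrelevant ideal. So modulo that ideal \<open>\<beta>\<close> is a left inverse of \<open>\<alpha>\<close> over the field.\<close>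

lemma minimal_resolution_rank_le:
  fixes I :: "('v::finite, 'k::field) polyring set"
  assumes I: "homogeneous_ideal I"
    and F: "minimal_graded_free_resolution I F" and G: "minimal_graded_free_resolution I G"
  shows "free_rank F i \<le> free_rank G i"
proof -
  have rF: "graded_free_resolution I F" and rG: "graded_free_resolution I G"
    using F G unfolding minimal_graded_free_resolution_def by blast+
  obtain \<alpha> where \<alpha>: "lifts_mult I 1 0 G F \<alpha>"
    using comparison_maps[OF I rG rF homogeneous_1] by auto
  obtain \<beta> where \<beta>: "lifts_mult I 1 0 F G \<beta>"
    using comparison_maps[OF I rF rG homogeneous_1] by auto
  note \<alpha>c = lifts_mult_carrier[OF \<alpha>] and \<beta>c = lifts_mult_carrier[OF \<beta>]
  note dF = resolution_carrier[OF rF] and dG = resolution_carrier[OF rG]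
  have \<alpha>_comm: "boundary G i * \<alpha> (Suc i) = \<alpha> i * boundary F i" for i
    using \<alpha> by (simp add: lifts_mult_def)
  have \<beta>_comm: "boundary F i * \<beta> (Suc i) = \<beta> i * boundary G i" for i
    using \<beta> by (simp add: lifts_mult_def)
  define \<psi> where "\<psi> i = \<beta> i * \<alpha> i - 1\<^sub>m (free_rank F i)" for i
  have \<beta>\<alpha>: "\<beta> i * \<alpha> i \<in> carrier_mat (free_rank F i) (free_rank F i)" for i
    by (rule mult_carrier_mat[OF \<beta>c \<alpha>c])
  have c: "\<psi> i \<in> carrier_mat (free_rank F i) (free_rank F i)" for i
    unfolding \<psi>_def by (rule minus_carrier_mat[OF one_carrier_mat])
  have "elements_mat (\<psi> i) \<subseteq> irrelevant_ideal"
  proof (rule null_homotopic_entries[OF F c])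
    fix i
    have "boundary F i * (\<beta> (Suc i) * \<alpha> (Suc i)) = \<beta> i * \<alpha> i * boundary F i"
      by (simp add: assoc_mult_mat[OF dF \<beta>c \<alpha>c, symmetric] \<beta>_comm assoc_mult_mat[OF \<beta>c dG \<alpha>c] \<alpha>_comm
          assoc_mult_mat[OF \<beta>c \<alpha>c dF])
    then show "boundary F i * \<psi> (Suc i) = \<psi> i * boundary F i"
      using dF[of i] by (simp add: \<psi>_def mult_minus_distrib_mat[OF dF \<beta>\<alpha> one_carrier_mat]
          minus_mult_distrib_mat[OF \<beta>\<alpha> one_carrier_mat dF])
  next
    fix u :: "('v, 'k) polyring vec" assume u: "u \<in> carrier_vec (free_rank F 0)"
    have \<alpha>u: "\<alpha> 0 *\<^sub>v u \<in> carrier_vec (free_rank G 0)" by (rule mult_mat_vec_carrier[OF \<alpha>c u])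
    have \<beta>\<alpha>u: "\<beta> 0 *\<^sub>v (\<alpha> 0 *\<^sub>v u) \<in> carrier_vec (free_rank F 0)" by (rule mult_mat_vec_carrier[OF \<beta>c \<alpha>u])
    have eq: "augmentation F \<bullet> (\<psi> 0 *\<^sub>v u) =
      (augmentation F \<bullet> (\<beta> 0 *\<^sub>v (\<alpha> 0 *\<^sub>v u)) - 1 * (augmentation G \<bullet> (\<alpha> 0 *\<^sub>v u))) +
      (augmentation G \<bullet> (\<alpha> 0 *\<^sub>v u) - 1 * (augmentation F \<bullet> u))"
      using u by (simp add: \<psi>_def minus_mult_distrib_mat_vec[OF \<beta>\<alpha> one_carrier_mat u]
          assoc_mult_mat_vec[OF \<beta>c \<alpha>c u]
          scalar_prod_minus_distrib[OF resolution_augmentation_carrier[OF rF] \<beta>\<alpha>u u])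
    have 1: "augmentation F \<bullet> (\<beta> 0 *\<^sub>v (\<alpha> 0 *\<^sub>v u)) - 1 * (augmentation G \<bullet> (\<alpha> 0 *\<^sub>v u)) \<in> I"
      using \<beta> \<alpha>u unfolding lifts_mult_def by blast
    have 2: "augmentation G \<bullet> (\<alpha> 0 *\<^sub>v u) - 1 * (augmentation F \<bullet> u) \<in> I"
      using \<alpha> u unfolding lifts_mult_def by blast
    show "augmentation F \<bullet> (\<psi> 0 *\<^sub>v u) \<in> I"
      unfolding eq by (rule homogeneous_ideal_add[OF I 1 2])
  qed
  then have "\<psi> i $$ (k, l) \<in> irrelevant_ideal" if "k < free_rank F i" "l < free_rank F i" for k l
    using that unfolding elements_mat_subset_iff[OF c] by blast
  then have \<psi>0: "Poly_Mapping.lookup (\<psi> i $$ (k, l)) 0 = 0" if "k < free_rank F i" "l < free_rank F i" for k l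
    using that by (intro lookup_0_irrelevant)
  let ?\<epsilon> = "map_mat (\<lambda>p :: ('v, 'k) polyring. Poly_Mapping.lookup p 0)"
  have "?\<epsilon> (\<beta> i) * ?\<epsilon> (\<alpha> i) = ?\<epsilon> (\<beta> i * \<alpha> i)"
    by (rule constant_term.mat_hom_mult[OF \<beta>c \<alpha>c, symmetric])
  also have "\<dots> = 1\<^sub>m (free_rank F i)"
  proof (rule eq_matI)
    fix k l assume "k < dim_row (1\<^sub>m (free_rank F i) :: 'k mat)" "l < dim_col (1\<^sub>m (free_rank F i) :: 'k mat)"
    then have kl: "k < free_rank F i" "l < free_rank F i" by simp_all
    have "(\<beta> i * \<alpha> i) $$ (k, l) = \<psi> i $$ (k, l) + 1\<^sub>m (free_rank F i) $$ (k, l)"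
      using kl \<beta>\<alpha>[of i] by (simp add: \<psi>_def del: index_mult_mat)
    then show "?\<epsilon> (\<beta> i * \<alpha> i) $$ (k, l) = 1\<^sub>m (free_rank F i) $$ (k, l)"
      using kl \<beta>\<alpha>[of i] \<psi>0[OF kl] by (simp add: lookup_add del: index_mult_mat)
  qed (use \<beta>\<alpha>[of i] in auto)
  finally show ?thesis
    using left_inverse_imp_le[of "?\<epsilon> (\<alpha> i)" "free_rank G i" "free_rank F i" "?\<epsilon> (\<beta> i)"] \<alpha>c[of i] \<beta>c[of i]
    by simp
qed

lemma minimal_resolution_rank_unique:
  fixes I :: "('v::finite, 'k::field) polyring set"
  assumes "homogeneous_ideal I"
    and "minimal_graded_free_resolution I F" "minimal_graded_free_resolution I G"
  shows "free_rank F i = free_rank G i"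
  by (rule antisym; rule minimal_resolution_rank_le[OF assms(1)]; rule assms)

section \<open>Ideals built by iterated cones\<close>

text \<open>\<open>last_betti A d c\<close> says that iterated cones produce a minimal resolution of \<open>S\<close> modulo the ideal of \<open>A\<close> of
length at most \<open>d\<close> with rank \<open>c\<close> in position \<open>d\<close>; \<open>c = 0\<close> is allowed and means length less than \<open>d\<close>.
It is an inductive predicate and not a statement about resolutions because the bound for vertex
deletion is proved by following the construction. The rule \<open>equiv\<close> allows two generating sets of one ideal.\<close>

inductive last_betti :: "'v::finite set set \<Rightarrow> nat \<Rightarrow> nat \<Rightarrow> bool" where
  zero: "last_betti {} 0 1"
| weaken: "last_betti A d c \<Longrightarrow> last_betti A (Suc d) 0"
| cone: "last_betti A (Suc d) c1 \<Longrightarrow> last_betti ((\<lambda>t. t - s) ` A) d c2 \<Longrightarrow> x \<notin> \<Union>A \<Longrightarrow> x \<notin> s \<Longrightarrow>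
    last_betti (insert (insert x s) A) (Suc d) (c1 + c2)"
| equiv: "last_betti A d c \<Longrightarrow> \<forall>s\<in>A. \<exists>t\<in>B. t \<subseteq> s \<Longrightarrow> \<forall>t\<in>B. \<exists>s\<in>A. s \<subseteq> t \<Longrightarrow> last_betti B d c"

lemma minimal_resolution_zero_ideal:
  "\<exists>F. minimal_graded_free_resolution ({0} :: ('v::finite, 'k::field) polyring set) F \<and>
     free_rank F 0 = 1 \<and> (\<forall>i>0. free_rank F i = 0)"
proof -
  define F :: "('v, 'k) polyring free_complex" where
    "F = \<lparr>shifts = \<lambda>i. if i = 0 then [0] else [], augmentation = vec 1 (\<lambda>_. 1),
      boundary = \<lambda>i. 0\<^sub>m (if i = 0 then 1 else 0) 0\<rparr>"
  have r: "free_rank F i = (if i = 0 then 1 else 0)" for i by (simp add: F_def free_rank_def)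
  have bd: "boundary F i = 0\<^sub>m (free_rank F i) 0" for i unfolding r by (simp add: F_def)
  have mult: "boundary F i *\<^sub>v w = 0\<^sub>v (free_rank F i)" if "w \<in> carrier_vec 0" for w i
    using that unfolding bd by (intro eq_vecI) (auto simp: scalar_prod_def)
  have im: "v \<in> mat_image (boundary F i) \<longleftrightarrow> v = 0\<^sub>v (free_rank F i)" for v i
  proof -
    have "boundary F i \<in> carrier_mat (free_rank F i) 0" unfolding bd by simp
    then show ?thesis using mat_image_iff mult zero_carrier_vec[of 0] by metis
  qed
  have aug: "augmentation F \<bullet> v = v $ 0" if "v \<in> carrier_vec 1" for v
    using that by (simp add: F_def scalar_prod_def)
  have sh: "shifts F i = (if i = 0 then [0] else [])" "augmentation F = vec 1 (\<lambda>_. 1)" for i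
    by (simp_all add: F_def)
  have "graded_free_complex F"
    unfolding graded_free_complex_def bd by (auto simp: r sh homogeneous_1)
  moreover have "\<exists>v\<in>carrier_vec (free_rank F 0). p - augmentation F \<bullet> v \<in> {0}" for p
    unfolding r by (rule bexI[of _ "vec 1 (\<lambda>_. p)"]) (auto simp: aug)
  moreover have "augmentation F \<bullet> v \<in> {0} \<longleftrightarrow> v \<in> mat_image (boundary F 0)"
    if "v \<in> carrier_vec (free_rank F 0)" for v
    using that unfolding im by (auto simp: r aug intro!: eq_vecI)
  moreover have "boundary F i *\<^sub>v v = 0\<^sub>v (free_rank F i) \<longleftrightarrow> v \<in> mat_image (boundary F (Suc i))"
    if "v \<in> carrier_vec (free_rank F (Suc i))" for v i
    using that mult[of v i] unfolding im by (auto simp: r)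
  ultimately have "graded_free_resolution {0} F"
    unfolding graded_free_resolution_def by blast
  moreover have "elements_mat (boundary F i) \<subseteq> irrelevant_ideal" for i
    unfolding bd by (auto dest!: elements_matD)
  ultimately have "minimal_graded_free_resolution {0} F"
    by (simp add: minimal_graded_free_resolution_def)
  then show ?thesis using r by (intro exI[of _ F]) simp
qed

lemma sqfree_ideal_mono:
  assumes "\<forall>s\<in>A. \<exists>t\<in>B. t \<subseteq> s"
  shows "sqfree_ideal A \<subseteq> sqfree_ideal B"
  unfolding sqfree_ideal_def
proof safe
  fix p :: "('a, 'b) polyring" and m
  assume "\<forall>m\<in>Poly_Mapping.keys p. \<exists>s\<in>A. s \<subseteq> Poly_Mapping.keys m" "m \<in> Poly_Mapping.keys p"
  then obtain s where "s \<in> A" "s \<subseteq> Poly_Mapping.keys m" by blast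
  then show "\<exists>s\<in>B. s \<subseteq> Poly_Mapping.keys m" using assms by (meson order_trans)
qed

text \<open>In the rule \<open>cone\<close> the colon ideal of the new generator is that of its factor with support \<open>s\<close>, since
\<open>x\<close> does not occur in the old ideal.\<close>

lemma last_betti_resolution:
  assumes "last_betti A d c"
  shows "\<exists>F. minimal_graded_free_resolution (sqfree_ideal A :: ('v::finite, 'k::field) polyring set) F \<and>
     (\<forall>i>d. free_rank F i = 0) \<and> free_rank F d = c"
  using assms
proof (induction rule: last_betti.induct)
  case zero
  have "(sqfree_ideal {} :: ('v, 'k) polyring set) = {0}"
    by (auto simp: sqfree_ideal_def)
  then show ?case using minimal_resolution_zero_ideal[where 'v='v and 'k='k] by auto
next
  case (weaken A d c)
  then obtain F where "minimal_graded_free_resolution (sqfree_ideal A :: ('v, 'k) polyring set) F"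
    "\<forall>i>d. free_rank F i = 0" by blast
  then show ?case by (intro exI[of _ F]) simp
next
  case (cone A d c1 s c2 x)
  let ?I = "sqfree_ideal A :: ('v, 'k) polyring set"
  let ?x = "Poly_Mapping.single (monomial_of {x}) 1 :: ('v, 'k) polyring"
  let ?g = "Poly_Mapping.single (monomial_of s) 1 :: ('v, 'k) polyring"
  obtain F where F: "minimal_graded_free_resolution ?I F" "\<forall>i>Suc d. free_rank F i = 0"
    "free_rank F (Suc d) = c1" using cone.IH(1) by blast
  obtain G where G: "minimal_graded_free_resolution (sqfree_ideal ((\<lambda>t. t - s) ` A) :: ('v, 'k) polyring set) G"
    "\<forall>i>d. free_rank G i = 0" "free_rank G d = c2" using cone.IH(2) by blast
  have A_x: "(\<lambda>t. t - {x}) ` A = A" using cone.hyps(3) by (force simp: image_iff)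
  have x_colon: "?x * p \<in> ?I \<longleftrightarrow> p \<in> ?I" for p
    by (simp add: A_x monomial_mult_in_sqfree_ideal)
  have K: "(sqfree_ideal ((\<lambda>t. t - s) ` A) :: ('v, 'k) polyring set) = {p. ?x * ?g * p \<in> ?I}"
    by (simp add: mult.assoc monomial_mult_in_sqfree_ideal A_x)
  have hom: "homogeneous (int (card t)) (Poly_Mapping.single (monomial_of t) (1 :: 'k))" for t :: "'v set"
    by (simp add: homogeneous_def mon_degree_monomial_of)
  have "?x * ?g = Poly_Mapping.single (monomial_of (insert x s)) 1"
    using cone.hyps(4) by (simp add: mult_single monomial_of_def)
  then have J: "{a + c * (?x * ?g) | a c. a \<in> ?I} = sqfree_ideal (insert (insert x s) A)"
    by (simp only: sqfree_ideal_insert)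
  obtain C where C: "minimal_graded_free_resolution (sqfree_ideal (insert (insert x s) A) :: ('v, 'k) polyring set) C"
    "\<forall>i. free_rank C i = free_rank F i + shifted_rank G i"
    using minimal_resolution_cone[OF homogeneous_ideal_sqfree F(1) G(1)[unfolded K] hom
        monomial_in_irrelevant_ideal x_colon[THEN iffD1] hom] unfolding J by blast
  have "shifted_rank G i = 0" if "i > Suc d" for i
    using that G(2) by (auto simp: shifted_rank_def split: nat.split)
  then show ?case using C F G by (intro exI[of _ C]) (auto simp: shifted_rank_def)
next
  case (equiv A d c B)
  have "(sqfree_ideal A :: ('v, 'k) polyring set) = sqfree_ideal B"
    by (intro equalityI sqfree_ideal_mono equiv.hyps(2,3))
  then show ?case using equiv.IH by simp
qed

lemma last_betti_betti_proj_dim: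
  assumes "last_betti A d 1"
  shows "betti (sqfree_ideal A :: ('v::finite, 'k::field) polyring set) (proj_dim (sqfree_ideal A :: ('v, 'k) polyring set)) = 1"
proof -
  let ?I = "sqfree_ideal A :: ('v, 'k) polyring set"
  obtain F where F: "minimal_graded_free_resolution ?I F"
    "\<forall>i>d. free_rank F i = 0" "free_rank F d = 1" using last_betti_resolution[OF assms] by blast
  have "minimal_graded_free_resolution ?I (the_min_resolution ?I)"
    unfolding the_min_resolution_def by (rule someI[of "minimal_graded_free_resolution ?I", OF F(1)])
  then have r: "free_rank (the_min_resolution ?I) i = free_rank F i" for i
    by (rule minimal_resolution_rank_unique[OF homogeneous_ideal_sqfree _ F(1)])
  have "proj_dim ?I = d"
    unfolding proj_dim_def r
  proof (rule Least_equality)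
    fix p assume "\<forall>i>p. free_rank F i = 0"
    then show "d \<le> p" using F(3) by (metis leI zero_neq_one)
  qed (use F(2) in blast)
  then show ?thesis by (simp add: betti_def r F(3))
qed

section \<open>Edge ideals of graphs with leaves\<close>

lemma last_betti_weaken:
  assumes "last_betti A d c" "d < e"
  shows "last_betti A e 0"
  using assms(2)
proof (induction e)
  case (Suc e)
  then show ?case
    using assms(1) last_betti.weaken by (cases "d = e") auto
qed simp

text \<open>Deleting a vertex, with all generators through it, does not lengthen the resolution: each cone either
disappears or is replaced by a cone over the two ideals with the vertex deleted.\<close>

lemma last_betti_delete_vertex:
  assumes "last_betti A d c"
  shows "\<exists>c'. last_betti {t \<in> A. v \<notin> t} d c'"
  using assms
proof (induction rule: last_betti.induct)
  case zero
  then show ?case using last_betti.zero by auto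
next
  case (weaken A d c)
  then show ?case using last_betti.weaken by blast
next
  case (cone A d c1 s c2 x)
  show ?case
  proof (cases "v \<in> insert x s")
    case True
    then have "{t \<in> insert (insert x s) A. v \<notin> t} = {t \<in> A. v \<notin> t}" by auto
    then show ?thesis using cone.IH(1) by simp
  next
    case False
    have "{t \<in> (\<lambda>t. t - s) ` A. v \<notin> t} = (\<lambda>t. t - s) ` {t \<in> A. v \<notin> t}"
      using False by auto
    then obtain c1' c2' where "last_betti {t \<in> A. v \<notin> t} (Suc d) c1'"
      "last_betti ((\<lambda>t. t - s) ` {t \<in> A. v \<notin> t}) d c2'"
      using cone.IH by auto
    then have "last_betti (insert (insert x s) {t \<in> A. v \<notin> t}) (Suc d) (c1' + c2')"
      using cone.hyps by (intro last_betti.cone) auto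
    moreover have "{t \<in> insert (insert x s) A. v \<notin> t} = insert (insert x s) {t \<in> A. v \<notin> t}"
      using False by auto
    ultimately show ?thesis by auto
  qed
next
  case (equiv A d c B)
  then obtain c' where "last_betti {t \<in> A. v \<notin> t} d c'" by blast
  moreover have "\<forall>s\<in>{t \<in> A. v \<notin> t}. \<exists>t\<in>{t \<in> B. v \<notin> t}. t \<subseteq> s"
    "\<forall>t\<in>{t \<in> B. v \<notin> t}. \<exists>s\<in>{t \<in> A. v \<notin> t}. s \<subseteq> t"
    using equiv.hyps by blast+
  ultimately show ?case using last_betti.equiv by blast
qed

lemma last_betti_delete_vertices:
  assumes "last_betti A d c" "finite V"
  shows "\<exists>c'. last_betti {t \<in> A. t \<inter> V = {}} d c'"
  using assms(2)
proof (induction V)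
  case empty
  then show ?case using assms(1) by auto
next
  case (insert v V)
  then obtain c' where "last_betti {t \<in> A. t \<inter> V = {}} d c'" by blast
  then obtain c'' where "last_betti {t \<in> {t \<in> A. t \<inter> V = {}}. v \<notin> t} d c''"
    using last_betti_delete_vertex by blast
  moreover have "{t \<in> {t \<in> A. t \<inter> V = {}}. v \<notin> t} = {t \<in> A. t \<inter> insert v V = {}}" by auto
  ultimately show ?case by auto
qed

text \<open>A new variable is a nonzerodivisor, so the cone is taken of the resolution and a copy of itself: the length
goes up by one and the last rank stays.\<close>

lemma last_betti_insert_singleton:
  assumes "last_betti A d c" "x \<notin> \<Union>A"
  shows "last_betti (insert {x} A) (Suc d) c"
  using last_betti.cone[OF last_betti.weaken[OF assms(1)], of "{}" c x] assms by simp

lemma last_betti_insert_singletons: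
  assumes "last_betti A d c" "finite N" "N \<inter> \<Union>A = {}"
  shows "last_betti ((\<lambda>v. {v}) ` N \<union> A) (d + card N) c"
  using assms(2,3)
proof (induction N)
  case (insert v N)
  then have "last_betti (insert {v} ((\<lambda>v. {v}) ` N \<union> A)) (Suc (d + card N)) c"
    by (intro last_betti_insert_singleton) auto
  then show ?case using insert.hyps by simp
qed (use assms(1) in simp)

definition nbrs :: "'v set set \<Rightarrow> 'v \<Rightarrow> 'v set" where
  "nbrs E y = {v. {y, v} \<in> E}"

text \<open>The colon ideal of the edge ideal by \<open>y\<close> contains the neighbours of \<open>y\<close> as variables; these absorb all edges
that meet \<open>y\<close> or one of its neighbours. The remaining edges involve none of these variables, so each
neighbour adds one to the length and keeps the last rank.\<close>

lemma last_betti_add_leaf: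
  assumes E: "simple_graph E" and x: "x \<notin> \<Union>E" "x \<noteq> y"
    and "last_betti E D c1" and "last_betti {e \<in> E. e \<inter> insert y (nbrs E y) = {}} d c2"
    and D: "D = Suc (d + card (nbrs E y))"
  shows "last_betti (insert {x, y} E) D (c1 + c2)"
proof -
  let ?N = "nbrs E y" and ?E' = "{e \<in> E. e \<inter> insert y (nbrs E y) = {}}"
  have "last_betti ((\<lambda>v. {v}) ` ?N \<union> ?E') (d + card ?N) c2"
    using assms(5) by (rule last_betti_insert_singletons) auto
  then have "last_betti ((\<lambda>e. e - {y}) ` E) (d + card ?N) c2"
  proof (rule last_betti.equiv)
    show "\<forall>s\<in>(\<lambda>v. {v}) ` ?N \<union> ?E'. \<exists>t\<in>(\<lambda>e. e - {y}) ` E. t \<subseteq> s"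
    proof
      fix s assume "s \<in> (\<lambda>v. {v}) ` ?N \<union> ?E'"
      then consider v where "s = {v}" "{y, v} \<in> E" | "s \<in> E" by (auto simp: nbrs_def)
      then show "\<exists>t\<in>(\<lambda>e. e - {y}) ` E. t \<subseteq> s"
      proof cases
        case 1
        show ?thesis by (rule bexI[OF _ imageI[OF 1(2)]]) (auto simp: 1(1))
      next
        case 2
        show ?thesis by (rule bexI[OF _ imageI[OF 2]]) auto
      qed
    qed
    have "\<exists>s\<in>(\<lambda>v. {v}) ` ?N \<union> ?E'. s \<subseteq> e - {y}" if e: "e \<in> E" for e
    proof (cases "y \<in> e")
      case True
      have "card e = 2" using E e by (simp add: simple_graph_def)
      then obtain u w where "e = {u, w}" "u \<noteq> w" by (auto simp: card_2_iff)
      then obtain v where v: "e = {y, v}" "v \<noteq> y" using True by blast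
      then have "{v} \<in> (\<lambda>v. {v}) ` ?N" using e by (simp add: nbrs_def)
      moreover have "{v} \<subseteq> e - {y}" using v by simp
      ultimately show ?thesis by blast
    next
      case False
      then have minus: "e - {y} = e" by simp
      show ?thesis
      proof (cases "e \<inter> ?N = {}")
        case True
        then have "e \<in> ?E'" using e False by simp
        then show ?thesis unfolding minus by blast
      qed (unfold minus, blast)
    qed
    then show "\<forall>t\<in>(\<lambda>e. e - {y}) ` E. \<exists>s\<in>(\<lambda>v. {v}) ` ?N \<union> ?E'. s \<subseteq> t" by blast
  qed
  then show ?thesis
    using last_betti.cone[of E "d + card ?N" c1 "{y}" c2 x] assms(4) x D by simp
qed

text \<open>The form of the leaf rule used for the terms that do not reach the top degree: \<open>E\<close> is the part of \<open>H\<close> whose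
resolution has length at most \<open>d\<close>, and the edges of \<open>H\<close> that survive in the colon ideal belong to \<open>E\<close>.\<close>

lemma last_betti_add_leaf_bound:
  assumes H: "simple_graph H" and x: "x \<notin> \<Union>H" "x \<noteq> y"
    and "last_betti H D 0" and "last_betti E d c" and "E \<subseteq> H"
    and meets: "\<And>e. e \<in> H - E \<Longrightarrow> e \<inter> insert y (nbrs H y) \<noteq> {}"
    and D: "Suc (d + card (nbrs H y)) < D"
  shows "last_betti (insert {x, y} H) D 0"
proof -
  have "{e \<in> H. e \<inter> insert y (nbrs H y) = {}} = {e \<in> E. e \<inter> insert y (nbrs H y) = {}}"
    using meets \<open>E \<subseteq> H\<close> by blast
  then obtain c' where c': "last_betti {e \<in> H. e \<inter> insert y (nbrs H y) = {}} d c'"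
    using last_betti_delete_vertices[OF assms(5), of "insert y (nbrs H y)"] by auto
  have "last_betti {e \<in> H. e \<inter> insert y (nbrs H y) = {}} (D - Suc (card (nbrs H y))) 0"
    by (rule last_betti_weaken[OF c']) (use D in linarith)
  from last_betti_add_leaf[OF H x assms(4) this] D show ?thesis by simp
qed

lemma simple_graph_insert: "simple_graph E \<Longrightarrow> u \<noteq> v \<Longrightarrow> simple_graph (insert {u, v} E)"
  by (simp add: simple_graph_def)

lemma simple_graph_member: "simple_graph E \<Longrightarrow> {u, v} \<in> E \<Longrightarrow> u \<noteq> v"
  by (auto simp: simple_graph_def)

lemma last_betti_add_cherry:
  assumes E: "simple_graph E" and "last_betti E d 1"
    and fresh: "{y, a, b} \<inter> \<Union>E = {}" and dist: "distinct [y, a, b]"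
  shows "last_betti ({{a, y}, {b, y}} \<union> E) (d + 2) 1"
proof -
  have n1: "nbrs E y = {}" using fresh by (auto simp: nbrs_def)
  have e1: "{e \<in> E. e \<inter> insert y (nbrs E y) = {}} = E" using fresh n1 by auto
  have 1: "last_betti (insert {a, y} E) (d + 2) (0 + 0)"
    by (rule last_betti_add_leaf[OF E, where d = "d + 1"], unfold e1)
       (use fresh dist n1 in \<open>auto intro!: last_betti_weaken[OF assms(2)]\<close>)
  have n2: "nbrs (insert {a, y} E) y = {a}" using fresh dist by (auto simp: nbrs_def doubleton_eq_iff)
  have e2: "{e \<in> insert {a, y} E. e \<inter> insert y (nbrs (insert {a, y} E) y) = {}} = E"
    using fresh unfolding n2 by auto
  have "last_betti (insert {b, y} (insert {a, y} E)) (d + 2) (0 + 1)"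
  proof (rule last_betti_add_leaf[OF simple_graph_insert[OF E], where d = d])
    show "last_betti {e \<in> insert {a, y} E. e \<inter> insert y (nbrs (insert {a, y} E) y) = {}} d 1"
      unfolding e2 by (rule assms(2))
    show "last_betti (insert {a, y} E) (d + 2) 0" using 1 by simp
  qed (use fresh dist n2 in auto)
  then show ?thesis by (simp add: insert_commute)
qed

text \<open>The leaves are added in the order \<open>p\<close> (if it is attached at all), \<open>z\<close>, \<open>a'\<close>, \<open>b'\<close>, \<open>y\<close>, \<open>a\<close>, \<open>b\<close>. Up to \<open>y\<close> every new leaf is
attached to a vertex with at most two neighbours, and what survives in the colon ideal is part of \<open>E\<close>; so
these cones stay below \<open>d + 4\<close>. At \<open>y\<close> the colon ideals keep \<open>E\<close> and the two edges at \<open>z\<close>, of length \<open>d + 2\<close>. The leaf \<open>a\<close>, with one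
neighbour of \<open>y\<close>, gives length \<open>d + 4\<close>, and only \<open>b\<close>, with two neighbours of \<open>y\<close>, reaches \<open>d + 5\<close>.\<close>

lemma last_betti_attach_tree:
  assumes E: "simple_graph E" and E_betti: "last_betti E d 1"
    and fresh: "{p, y, a, b, z, a', b'} \<inter> \<Union>E = {}" and dist: "distinct [p, y, a, b, z, a', b']"
    and U: "U = {} \<or> (\<exists>q. U = {{p, q}} \<and> q \<notin> {p, y, a, b, z, a', b'} \<and> card (nbrs E q) \<le> 2)"
  shows "last_betti ({{b, y}, {a, y}, {y, p}, {b', z}, {a', z}, {z, p}} \<union> U \<union> E) (d + 5) 1"
proof -
  define Q where "Q = {q. {p, q} \<in> U}"
  have "Q = {} \<or> (\<exists>q. Q = {q})"
    using U by (auto simp: Q_def doubleton_eq_iff)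
  then have cQ: "card Q \<le> 1" "finite Q" by auto
  have UQ: "e \<in> U \<Longrightarrow> \<exists>q. e = {p, q} \<and> q \<noteq> p \<and> q \<notin> {y, a, b, z, a', b'}" for e
    using U by auto
  have fr: "\<And>e v. e \<in> E \<Longrightarrow> v \<in> {p, y, a, b, z, a', b'} \<Longrightarrow> v \<notin> e" using fresh by blast
  define H1 where "H1 = U \<union> E"
  define H2 where "H2 = insert {z, p} H1"
  define H3 where "H3 = insert {a', z} H2"
  define H4 where "H4 = insert {b', z} H3"
  define H5 where "H5 = insert {y, p} H4"
  define H6 where "H6 = insert {a, y} H5"
  note Hs = H1_def H2_def H3_def H4_def H5_def H6_def
  have fH1: "{y, a, b, z, a', b'} \<inter> \<Union>H1 = {}" using fresh U dist unfolding H1_def by auto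
  have s1: "simple_graph H1"
    using E U unfolding H1_def simple_graph_def by auto
  have s2: "simple_graph H2" unfolding H2_def using s1 dist by (intro simple_graph_insert) auto
  have s3: "simple_graph H3" unfolding H3_def using s2 dist by (intro simple_graph_insert) auto
  have s4: "simple_graph H4" unfolding H4_def using s3 dist by (intro simple_graph_insert) auto
  have s5: "simple_graph H5" unfolding H5_def using s4 dist by (intro simple_graph_insert) auto
  have s6: "simple_graph H6" unfolding H6_def using s5 dist by (intro simple_graph_insert) auto
  have n1: "nbrs H1 p = Q"
    using fresh by (auto simp: nbrs_def H1_def Q_def)
  have n2: "nbrs H2 z = {p}"
    using fH1 dist by (auto simp: nbrs_def H2_def doubleton_eq_iff)
  have n3: "nbrs H3 z = {p, a'}"
    using n2 dist unfolding H3_def by (auto simp: nbrs_def doubleton_eq_iff)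
  have n4: "nbrs H4 p = insert z Q"
    using n1 dist unfolding H4_def H3_def H2_def by (auto simp: nbrs_def doubleton_eq_iff)
  have n5: "nbrs H5 y = {p}"
    using fH1 dist unfolding H5_def H4_def H3_def H2_def by (auto simp: nbrs_def doubleton_eq_iff)
  have n6: "nbrs H6 y = {p, a}"
    using n5 dist unfolding H6_def by (auto simp: nbrs_def doubleton_eq_iff)
  have b0: "last_betti E (d + 4) 0" by (rule last_betti_weaken[OF E_betti]) simp
  have b1: "last_betti H1 (d + 4) 0"
  proof (cases "U = {}")
    case False
    then obtain q where q: "U = {{p, q}}" "q \<notin> {p, y, a, b, z, a', b'}" "card (nbrs E q) \<le> 2"
      using U by blast
    have "last_betti (insert {p, q} E) (d + 4) 0"
      by (rule last_betti_add_leaf_bound[OF E _ _ b0 E_betti]) (use fresh q in auto)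
    then show ?thesis by (simp add: H1_def q(1))
  qed (simp add: H1_def b0)
  have b2: "last_betti H2 (d + 4) 0"
    unfolding H2_def
    by (rule last_betti_add_leaf_bound[OF s1 _ _ b1 E_betti], unfold n1)
       (use fH1 dist UQ cQ in \<open>auto simp: H1_def\<close>)
  have b3: "last_betti H3 (d + 4) 0"
    unfolding H3_def
    by (rule last_betti_add_leaf_bound[OF s2 _ _ b2 E_betti], unfold n2)
       (use fH1 dist UQ in \<open>auto simp: H1_def H2_def\<close>)
  have b4: "last_betti H4 (d + 4) 0"
    unfolding H4_def
    by (rule last_betti_add_leaf_bound[OF s3 _ _ b3 E_betti], unfold n3)
       (use fH1 dist UQ in \<open>auto simp: H1_def H2_def H3_def\<close>)
  have b5: "last_betti H5 (d + 4) 0"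
    unfolding H5_def
    by (rule last_betti_add_leaf_bound[OF s4 _ _ b4 E_betti], unfold n4)
       (use fH1 dist UQ cQ in \<open>auto simp: H1_def H2_def H3_def H4_def card_insert_if\<close>)
  \<comment> \<open>removing \<open>p\<close> isolates the path \<open>a' - z - b'\<close>, which adds 2 to the length and keeps the last rank\<close>
  let ?S = "{{a', z}, {b', z}} \<union> E"
  have S: "last_betti ?S (d + 2) 1"
    by (rule last_betti_add_cherry[OF E E_betti]) (use fresh dist in auto)
  have e5: "{e \<in> H5. e \<inter> insert y (nbrs H5 y) = {}} = ?S"
    unfolding n5 using fr UQ dist by (auto simp: Hs)
  have "last_betti H6 (d + 5) (0 + 0)"
    unfolding H6_def
  proof (rule last_betti_add_leaf[OF s5 _ _ _ _, where d = "d + 3"])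
    show "last_betti {e \<in> H5. e \<inter> insert y (nbrs H5 y) = {}} (d + 3) 0"
      unfolding e5 by (rule last_betti_weaken[OF S]) simp
    show "last_betti H5 (d + 5) 0" by (rule last_betti_weaken[OF b5]) simp
  qed (use fH1 dist n5 in \<open>auto simp: H5_def H4_def H3_def H2_def\<close>)
  then have b6: "last_betti H6 (d + 5) 0" by simp
  have e6: "{e \<in> H6. e \<inter> insert y (nbrs H6 y) = {}} = ?S"
    unfolding n6 using fr UQ dist by (auto simp: Hs)
  have "last_betti (insert {b, y} H6) (d + 5) (0 + 1)"
  proof (rule last_betti_add_leaf[OF s6 _ _ b6 _, where d = "d + 2"])
    show "last_betti {e \<in> H6. e \<inter> insert y (nbrs H6 y) = {}} (d + 2) 1"
      unfolding e6 by (rule S)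
  qed (use fH1 dist n6 in \<open>auto simp: H6_def H5_def H4_def H3_def H2_def\<close>)
  moreover have "insert {b, y} H6 = {{b, y}, {a, y}, {y, p}, {b', z}, {a', z}, {z, p}} \<union> U \<union> E"
    by (simp only: Hs Un_insert_left Un_empty_left)
  ultimately show ?thesis by simp
qed

section \<open>Binary forests, level by level\<close>

text \<open>A perfect binary tree of height \<open>h\<close>, or a disjoint union of such trees, in terms of children and levels:
the form in which subtrees can be cut off level by level.\<close>

locale binary_level_forest =
  fixes ch :: "'v::finite \<Rightarrow> 'v set" and lev :: "'v \<Rightarrow> nat" and h :: nat
  assumes lev_child: "w \<in> ch v \<Longrightarrow> lev w = Suc (lev v)"
    and parent_unique: "w \<in> ch v \<Longrightarrow> w \<in> ch v' \<Longrightarrow> v = v'"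
    and parent_exists: "lev w = Suc n \<Longrightarrow> \<exists>v. w \<in> ch v"
    and two_children: "lev v < h \<Longrightarrow> card (ch v) = 2"
begin

text \<open>The bound concerns the child, so these are the edges within the levels \<open>0, \<dots>, k - 1\<close>; for a perfect
binary tree of height \<open>h\<close>, all edges are obtained with \<open>k = h + 1\<close>.\<close>

definition edges_below :: "nat \<Rightarrow> 'v set set" where
  "edges_below k = {{v, w} | v w. w \<in> ch v \<and> lev w < k}"

text \<open>The perfect binary tree of height 2 with root \<open>p\<close>, together with the edge from \<open>p\<close> to its parent if there is one.\<close>

definition block :: "'v \<Rightarrow> 'v set set" where
  "block p = {{p, v} | v. p \<in> ch v} \<union> {{y, p} | y. y \<in> ch p} \<union> {{a, y} | a y. y \<in> ch p \<and> a \<in> ch y}"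

lemma simple_graph_level:
  assumes "\<forall>e\<in>E. \<exists>v w. e = {v, w} \<and> w \<in> ch v"
  shows "simple_graph E"
  unfolding simple_graph_def
proof
  fix e assume "e \<in> E"
  then obtain v w where "e = {v, w}" "w \<in> ch v" using assms by blast
  moreover have "v \<noteq> w" using lev_child[OF \<open>w \<in> ch v\<close>] by auto
  ultimately show "card e = 2" by simp
qed

lemma edges_belowE:
  assumes "e \<in> edges_below k"
  obtains v w where "e = {v, w}" "w \<in> ch v" "lev w < k"
  using assms by (auto simp: edges_below_def)

lemma edges_below_3:
  "edges_below (Suc (Suc (Suc m))) = edges_below m \<union> (\<Union>p\<in>{p. lev p = m}. block p)"
proof
  show "edges_below (Suc (Suc (Suc m))) \<subseteq> edges_below m \<union> (\<Union>p\<in>{p. lev p = m}. block p)"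
  proof
    fix e assume "e \<in> edges_below (Suc (Suc (Suc m)))"
    then obtain v w where e: "e = {v, w}" "w \<in> ch v" "lev w < Suc (Suc (Suc m))" by (rule edges_belowE)
    then consider "lev w < m" | "lev w = m" | "lev v = m" | "lev v = Suc m"
      using lev_child[OF e(2)] by linarith
    then show "e \<in> edges_below m \<union> (\<Union>p\<in>{p. lev p = m}. block p)"
    proof cases
      case 1
      then show ?thesis using e by (auto simp: edges_below_def)
    next
      case 2
      then have "e \<in> block w" using e by (auto simp: block_def)
      then show ?thesis using 2 by blast
    next
      case 3
      then have "e \<in> block v" using e by (auto simp: block_def)
      then show ?thesis using 3 by blast
    next
      case 4
      then obtain p where p: "v \<in> ch p" using parent_exists by blast
      then have "e \<in> block p" using e unfolding block_def by blast
      moreover have "lev p = m" using lev_child[OF p] 4 by simp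
      ultimately show ?thesis by blast
    qed
  qed
next
  have "block p \<subseteq> edges_below (Suc (Suc (Suc m)))" if "lev p = m" for p
  proof
    fix e assume "e \<in> block p"
    then consider v where "e = {v, p}" "p \<in> ch v" | y where "e = {p, y}" "y \<in> ch p"
      | a y where "e = {y, a}" "y \<in> ch p" "a \<in> ch y"
      unfolding block_def by blast
    then show "e \<in> edges_below (Suc (Suc (Suc m)))"
    proof cases
      case 1
      then show ?thesis using that unfolding edges_below_def by (intro CollectI exI[of _ v] exI[of _ p]) simp
    next
      case 2
      then show ?thesis using that lev_child[OF 2(2)] unfolding edges_below_def
        by (intro CollectI exI[of _ p] exI[of _ y]) simp
    next
      case 3
      then show ?thesis using that lev_child[OF 3(2)] lev_child[OF 3(3)] unfolding edges_below_def
        by (intro CollectI exI[of _ y] exI[of _ a]) simp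
    qed
  qed
  moreover have "edges_below m \<subseteq> edges_below (Suc (Suc (Suc m)))"
    unfolding edges_below_def by fastforce
  ultimately show "edges_below m \<union> (\<Union>p\<in>{p. lev p = m}. block p) \<subseteq> edges_below (Suc (Suc (Suc m)))"
    by blast
qed

lemma children_pair:
  assumes "lev v < h"
  obtains a b where "ch v = {a, b}" "a \<noteq> b"
  using two_children[OF assms] by (auto simp: card_2_iff)

lemma last_betti_blocks:
  assumes h: "Suc m < h" and base: "\<exists>d. last_betti (edges_below m) d 1"
    and "finite P" "P \<subseteq> {p. lev p = m}"
  shows "\<exists>d. last_betti (edges_below m \<union> (\<Union>p\<in>P. block p)) d 1"
  using assms(3,4)
proof (induction P)
  case empty
  then show ?case using base by simp
next
  case (insert p P)
  let ?E = "edges_below m \<union> (\<Union>p\<in>P. block p)"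
  obtain d where d: "last_betti ?E d 1" using insert by auto
  have lev_p: "lev p = m" and lev_P: "\<And>p'. p' \<in> P \<Longrightarrow> lev p' = m" using insert.prems by auto
  \<comment> \<open>the parent edges of the other blocks count as edges of the first kind\<close>
  have cases_E: thesis
    if e: "e \<in> ?E" and low: "\<And>v w. e = {v, w} \<Longrightarrow> w \<in> ch v \<Longrightarrow> lev w \<le> m \<Longrightarrow> w \<noteq> p \<Longrightarrow> thesis"
      and mid: "\<And>p' y. e = {p', y} \<Longrightarrow> y \<in> ch p' \<Longrightarrow> p' \<in> P \<Longrightarrow> thesis"
      and high: "\<And>p' y a. e = {y, a} \<Longrightarrow> a \<in> ch y \<Longrightarrow> y \<in> ch p' \<Longrightarrow> p' \<in> P \<Longrightarrow> thesis"
    for e thesis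
    using e
  proof
    assume "e \<in> edges_below m"
    then show thesis using low lev_p by (elim edges_belowE) force
  next
    assume "e \<in> (\<Union>p\<in>P. block p)"
    then obtain p' where p': "p' \<in> P" "e \<in> block p'" by blast
    then consider v where "e = {v, p'}" "p' \<in> ch v" | y where "e = {p', y}" "y \<in> ch p'"
      | a y where "e = {y, a}" "y \<in> ch p'" "a \<in> ch y"
      unfolding block_def by blast
    then show thesis
    proof cases
      case 1
      then show thesis using low[of v p'] p'(1) lev_P insert.hyps(2) by auto
    next
      case 2
      then show thesis using mid p'(1) by blast
    next
      case 3
      then show thesis using high p'(1) by blast
    qed
  qed
  have edge_E: "\<exists>v w. e = {v, w} \<and> w \<in> ch v" if "e \<in> ?E" for e
    using that by (rule cases_E) blast+
  have E: "simple_graph ?E" by (rule simple_graph_level) (use edge_E in blast)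
  have h_p: "lev p < h" using lev_p h by simp
  obtain y z where yz: "ch p = {y, z}" "y \<noteq> z" using children_pair[OF h_p] .
  then have lev_yz: "lev y = Suc m" "lev z = Suc m" using lev_child lev_p by auto
  then obtain a b where ab: "ch y = {a, b}" "a \<noteq> b" using children_pair[of y] h by auto
  obtain a' b' where ab': "ch z = {a', b'}" "a' \<noteq> b'" using children_pair[of z] h lev_yz by auto
  have lev_ab: "lev a = Suc (Suc m)" "lev b = Suc (Suc m)" "lev a' = Suc (Suc m)" "lev b' = Suc (Suc m)"
    using lev_child[of _ y] lev_child[of _ z] ab ab' lev_yz by auto
  have dist_ab: "a \<noteq> a'" "a \<noteq> b'" "b \<noteq> a'" "b \<noteq> b'"
    using parent_unique[of _ y z] ab ab' yz(2) by auto
  have dist: "distinct [p, y, a, b, z, a', b']"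
    using yz ab ab' lev_p lev_yz lev_ab dist_ab by auto
  have p_fresh: "p \<notin> e" if "e \<in> ?E" for e
    using that
  proof (rule cases_E)
    fix v w assume vw: "e = {v, w}" "w \<in> ch v" "lev w \<le> m" "w \<noteq> p"
    have "p \<noteq> v" using lev_child[OF vw(2)] vw(3) lev_p by auto
    then show ?thesis using vw(1,4) by simp
  next
    fix p' y assume py: "e = {p', y}" "y \<in> ch p'" "p' \<in> P"
    have "p \<noteq> p'" using py(3) insert.hyps(2) by blast
    moreover have "p \<noteq> y" using lev_child[OF py(2)] lev_P[OF py(3)] lev_p by auto
    ultimately show ?thesis using py(1) by simp
  next
    fix p' y a assume ya: "e = {y, a}" "a \<in> ch y" "y \<in> ch p'" "p' \<in> P"
    have "p \<noteq> y" "p \<noteq> a"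
      using lev_child[OF ya(2)] lev_child[OF ya(3)] lev_P[OF ya(4)] lev_p by auto
    then show ?thesis using ya(1) by simp
  qed
  have child_fresh: "u \<notin> e" if "e \<in> ?E" "u \<in> ch p" for e u
    using that(1)
  proof (rule cases_E)
    fix v w assume vw: "e = {v, w}" "w \<in> ch v" "lev w \<le> m"
    have "u \<noteq> v" "u \<noteq> w" using lev_child[OF vw(2)] vw(3) lev_child[OF that(2)] lev_p by auto
    then show ?thesis using vw(1) by simp
  next
    fix p' y assume py: "e = {p', y}" "y \<in> ch p'" "p' \<in> P"
    have "u \<noteq> p'" using lev_child[OF that(2)] lev_p lev_P[OF py(3)] by auto
    moreover have "u \<noteq> y"
      using parent_unique[OF that(2)] py(2,3) insert.hyps(2) by blast
    ultimately show ?thesis using py(1) by simp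
  next
    fix p' y a assume ya: "e = {y, a}" "a \<in> ch y" "y \<in> ch p'" "p' \<in> P"
    have "u \<noteq> y"
      using parent_unique[OF that(2)] ya(3,4) insert.hyps(2) by blast
    moreover have "u \<noteq> a"
      using lev_child[OF ya(2)] lev_child[OF ya(3)] lev_child[OF that(2)] lev_p lev_P[OF ya(4)] by auto
    ultimately show ?thesis using ya(1) by simp
  qed
  have grandchild_fresh: "u \<notin> e" if "e \<in> ?E" "u \<in> ch x" "x \<in> ch p" for e u x
    using that(1)
  proof (rule cases_E)
    fix v w assume vw: "e = {v, w}" "w \<in> ch v" "lev w \<le> m"
    have "u \<noteq> v" "u \<noteq> w"
      using lev_child[OF vw(2)] vw(3) lev_child[OF that(2)] lev_child[OF that(3)] lev_p by auto
    then show ?thesis using vw(1) by simp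
  next
    fix p' y assume py: "e = {p', y}" "y \<in> ch p'" "p' \<in> P"
    have "u \<noteq> p'" "u \<noteq> y"
      using lev_child[OF py(2)] lev_child[OF that(2)] lev_child[OF that(3)] lev_p lev_P[OF py(3)] by auto
    then show ?thesis using py(1) by simp
  next
    fix p' y a assume ya: "e = {y, a}" "a \<in> ch y" "y \<in> ch p'" "p' \<in> P"
    have "u \<noteq> y"
      using lev_child[OF ya(3)] lev_child[OF that(2)] lev_child[OF that(3)] lev_p lev_P[OF ya(4)] by auto
    moreover have "u \<noteq> a"
    proof
      assume "u = a"
      then have "y = x" using parent_unique ya(2) that(2) by blast
      then have "p' = p" using parent_unique ya(3) that(3) by blast
      then show False using ya(4) insert.hyps(2) by simp
    qed
    ultimately show ?thesis using ya(1) by simp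
  qed
  have fresh: "{p, y, a, b, z, a', b'} \<inter> \<Union>?E = {}"
  proof -
    have "u \<notin> e" if e: "e \<in> ?E" and u: "u \<in> {p, y, a, b, z, a', b'}" for u e
    proof -
      have ch: "y \<in> ch p" "z \<in> ch p" "a \<in> ch y" "b \<in> ch y" "a' \<in> ch z" "b' \<in> ch z"
        using yz ab ab' by auto
      note fr = p_fresh[OF e] child_fresh[OF e ch(1)] child_fresh[OF e ch(2)]
        grandchild_fresh[OF e ch(3,1)] grandchild_fresh[OF e ch(4,1)]
        grandchild_fresh[OF e ch(5,2)] grandchild_fresh[OF e ch(6,2)]
      show ?thesis using u unfolding insert_iff empty_iff by (elim disjE FalseE) (simp_all add: fr)
    qed
    then show ?thesis by blast
  qed
  define U where "U = {{p, v} | v. p \<in> ch v}"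
  have U: "U = {} \<or> (\<exists>q. U = {{p, q}} \<and> q \<notin> {p, y, a, b, z, a', b'} \<and> card (nbrs ?E q) \<le> 2)"
  proof (cases "\<exists>q. p \<in> ch q")
    case True
    then obtain q where q: "p \<in> ch q" by blast
    have "U = {{p, q}}" unfolding U_def using q parent_unique[OF q] by blast
    moreover have lev_q: "Suc (lev q) = m" using lev_child[OF q] lev_p by simp
    moreover have "q \<notin> {p, y, a, b, z, a', b'}" using lev_q lev_p lev_yz lev_ab by auto
    moreover have "card (nbrs ?E q) \<le> 2"
    proof -
      have sub: "nbrs ?E q \<subseteq> {v. q \<in> ch v} \<union> (ch q - {p})"
      proof
        fix u assume "u \<in> nbrs ?E q"
        then have qu: "{q, u} \<in> ?E" by (simp add: nbrs_def)
        have "u \<noteq> p" using p_fresh[OF qu] by auto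
        moreover obtain v w where "{q, u} = {v, w}" "w \<in> ch v" using edge_E[OF qu] by blast
        ultimately show "u \<in> {v. q \<in> ch v} \<union> (ch q - {p})" by (auto simp: doubleton_eq_iff)
      qed
      have "card (ch q) = 2" using two_children lev_q h by simp
      then have "card (ch q - {p}) = 1" using q by simp
      moreover have "card {v. q \<in> ch v} \<le> 1"
      proof (cases "\<exists>v. q \<in> ch v")
        case True
        then obtain v where "{v. q \<in> ch v} = {v}" using parent_unique by blast
        then show ?thesis by simp
      qed simp
      ultimately have "card ({v. q \<in> ch v} \<union> (ch q - {p})) \<le> 2"
        using card_Un_le[of "{v. q \<in> ch v}" "ch q - {p}"] by linarith
      then show ?thesis using card_mono[OF finite sub] by simp
    qed
    ultimately show ?thesis by blast
  qed (simp add: U_def)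
  have block_p: "block p = {{b, y}, {a, y}, {y, p}, {b', z}, {a', z}, {z, p}} \<union> U"
  proof -
    have "{{x, p} | x. x \<in> {y, z}} = {{y, p}, {z, p}}" by blast
    moreover have "{{u, x} | u x. x \<in> {y, z} \<and> u \<in> ch x} = {{b, y}, {a, y}, {b', z}, {a', z}}"
      using ab(1) ab'(1) by auto
    ultimately have eq: "block p = U \<union> {{y, p}, {z, p}} \<union> {{b, y}, {a, y}, {b', z}, {a', z}}"
      unfolding block_def U_def yz(1) by simp
    show ?thesis
      unfolding eq by (rule Set.set_eqI) (unfold Un_iff insert_iff empty_iff, safe; simp)
  qed
  have "edges_below m \<union> (\<Union>p\<in>insert p P. block p) = block p \<union> ?E"
    by blast
  moreover have "last_betti (block p \<union> ?E) (d + 5) 1"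
    unfolding block_p by (rule last_betti_attach_tree[OF E d fresh dist U])
  ultimately show ?case by (intro exI[of _ "d + 5"]) simp
qed

lemma last_betti_cherries:
  assumes h: "0 < h" and "finite P" "P \<subseteq> {p. lev p = 0}"
  shows "\<exists>d. last_betti {{p, y} | p y. p \<in> P \<and> y \<in> ch p} d 1"
  using assms(2,3)
proof (induction P)
  case empty
  then show ?case using last_betti.zero by auto
next
  case (insert p P)
  let ?E = "{{p, y} | p y. p \<in> P \<and> y \<in> ch p}"
  obtain d where d: "last_betti ?E d 1" using insert by auto
  have lev_p: "lev p = 0" and lev_P: "\<And>p'. p' \<in> P \<Longrightarrow> lev p' = 0" using insert.prems by auto
  obtain a b where ab: "ch p = {a, b}" "a \<noteq> b" using children_pair[of p] h lev_p by auto
  have lev_ab: "lev a = 1" "lev b = 1" using lev_child[of _ p] ab lev_p by auto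
  have "u \<notin> e" if eE: "e \<in> ?E" and u: "u \<in> {p, a, b}" for e u
  proof -
    obtain p' y where e: "e = {p', y}" "p' \<in> P" "y \<in> ch p'" using eE by blast
    have "p' \<noteq> p" using e(2) insert.hyps(2) by blast
    then have "a \<noteq> y" "b \<noteq> y" using parent_unique[OF e(3), of p] ab by auto
    then show ?thesis
      using u e \<open>p' \<noteq> p\<close> lev_child[OF e(3)] lev_P[OF e(2)] lev_p lev_ab by auto
  qed
  then have fresh: "{p, a, b} \<inter> \<Union>?E = {}" by blast
  have dist: "distinct [p, a, b]" using ab lev_p lev_ab by auto
  have "simple_graph ?E" by (rule simple_graph_level) blast
  from last_betti_add_cherry[OF this d fresh dist]
  have "last_betti ({{a, p}, {b, p}} \<union> ?E) (d + 2) 1" .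
  moreover have "{{p', y} | p' y. p' \<in> insert p P \<and> y \<in> ch p'} = {{a, p}, {b, p}} \<union> ?E"
    using ab(1) by (auto simp: insert_commute)
  ultimately show ?case by auto
qed

text \<open>Three levels are removed at a time, as blocks rooted at the third level from below. The cases without
edges, and with stars of two edges, start the induction; for \<open>k = 3\<close> the blocks are whole trees.\<close>

lemma last_betti_edges_below: "k \<le> Suc h \<Longrightarrow> \<exists>d. last_betti (edges_below k) d 1"
proof (induction k rule: less_induct)
  case (less k)
  consider "k \<le> 1" | "k = 2" | m where "k = Suc (Suc (Suc m))"
    by (metis One_nat_def le_Suc_eq le_zero_eq not0_implies_Suc numeral_2_eq_2)
  then show ?case
  proof cases
    case 1
    then have "edges_below k = {}" using lev_child by (fastforce simp: edges_below_def)
    then show ?thesis using last_betti.zero by auto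
  next
    case 2
    have "edges_below 2 = {{p, y} | p y. p \<in> {p. lev p = 0} \<and> y \<in> ch p}"
      using lev_child by (fastforce simp: edges_below_def)
    then show ?thesis using last_betti_cherries[of "{p. lev p = 0}"] less.prems 2 by auto
  next
    case 3
    then show ?thesis
      using last_betti_blocks[of m "{p. lev p = m}"] less unfolding 3 edges_below_3 by auto
  qed
qed

end

section \<open>Perfect binary trees\<close>

text \<open>A walk that returns to a vertex is cut back to its first visit.\<close>

lemma rtrancl_distinct_path:
  assumes "(u, v) \<in> R\<^sup>*"
  shows "\<exists>xs. xs \<noteq> [] \<and> hd xs = u \<and> last xs = v \<and> distinct xs \<and> set xs \<subseteq> insert u (Range R) \<and>
    successively (\<lambda>a b. (a, b) \<in> R) xs"
  using assms
proof (induction rule: rtrancl_induct)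
  case base
  show ?case by (rule exI[of _ "[u]"]) simp
next
  case (step v w)
  then obtain xs where xs: "xs \<noteq> []" "hd xs = u" "last xs = v" "distinct xs"
    "set xs \<subseteq> insert u (Range R)" "successively (\<lambda>a b. (a, b) \<in> R) xs" by blast
  show ?case
  proof (cases "w \<in> set xs")
    case True
    then obtain as bs where "xs = as @ w # bs" by (meson split_list)
    then have "xs = (as @ [w]) @ bs" by simp
    then show ?thesis
      using xs by (intro exI[of _ "as @ [w]"]) (auto simp: successively_append_iff hd_append)
  next
    case False
    then show ?thesis
      using xs step.hyps(2) by (intro exI[of _ "xs @ [w]"]) (auto simp: successively_append_iff)
  qed
qed

context
  fixes E :: "'v::finite set set" and r :: 'v
  assumes tree: "is_tree E"
begin

abbreviation (input) \<delta> where "\<delta> \<equiv> graph_dist E r"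

lemma tree_simple: "simple_graph E" and tree_connected: "connected_graph E"
  and tree_acyclic: "\<not> is_cycle E xs"
  using tree by (auto simp: is_tree_def)

lemma shortest_walk: "\<exists>xs. walk_betw E r v xs \<and> length xs = Suc (\<delta> v)"
proof -
  obtain xs where xs: "walk_betw E r v xs" using tree_connected unfolding connected_graph_def by blast
  then have "length xs = Suc (length xs - 1)" by (cases xs) (auto simp: walk_betw_def is_walk_def)
  then have "\<exists>n xs. walk_betw E r v xs \<and> length xs = Suc n" using xs by blast
  then show ?thesis unfolding graph_dist_def by (rule LeastI_ex)
qed

lemma dist_le_walk: "walk_betw E r v xs \<Longrightarrow> length xs = Suc n \<Longrightarrow> \<delta> v \<le> n"
  unfolding graph_dist_def by (rule Least_le) blast

lemma dist_edge:
  assumes "{u, v} \<in> E"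
  shows "\<delta> v \<le> Suc (\<delta> u)"
proof -
  obtain xs where xs: "walk_betw E r u xs" "length xs = Suc (\<delta> u)" using shortest_walk by blast
  then have "walk_betw E r v (xs @ [v])"
    using assms by (auto simp: walk_betw_def is_walk_def successively_append_iff)
  then show ?thesis by (rule dist_le_walk) (simp add: xs(2))
qed

lemma dist_root: "\<delta> r = 0"
  using dist_le_walk[of r "[r]" 0] by (simp add: walk_betw_def is_walk_def)

lemma dist_parent:
  assumes "v \<noteq> r"
  shows "\<exists>u. {u, v} \<in> E \<and> \<delta> v = Suc (\<delta> u)"
proof -
  obtain xs where xs: "walk_betw E r v xs" "length xs = Suc (\<delta> v)" using shortest_walk by blast
  then have "xs \<noteq> []" "last xs = v" by (auto simp: walk_betw_def is_walk_def)
  then obtain ys where ys: "xs = ys @ [v]" by (metis append_butlast_last_id)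
  have "ys \<noteq> []" using assms xs(1) unfolding ys by (auto simp: walk_betw_def)
  then have "walk_betw E r (last ys) ys" "{last ys, v} \<in> E"
    using xs(1) unfolding ys by (auto simp: walk_betw_def is_walk_def successively_append_iff)
  moreover have "length ys = \<delta> v" using xs(2) ys by simp
  moreover have "length ys = Suc (length ys - 1)" using \<open>ys \<noteq> []\<close> by (cases ys) auto
  ultimately have "\<delta> (last ys) \<le> length ys - 1" "{last ys, v} \<in> E"
    using dist_le_walk by blast+
  then have "Suc (\<delta> (last ys)) \<le> \<delta> v" using \<open>length ys = \<delta> v\<close> \<open>ys \<noteq> []\<close> by (cases ys) auto
  then show ?thesis using dist_edge[OF \<open>{last ys, v} \<in> E\<close>] \<open>{last ys, v} \<in> E\<close> by (intro exI[of _ "last ys"]) auto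
qed

lemma reach_root_avoiding:
  assumes "\<delta> v \<le> \<delta> w" "v \<noteq> w"
  shows "(v, r) \<in> {(a, b). {a, b} \<in> E \<and> a \<noteq> w \<and> b \<noteq> w}\<^sup>*"
  using assms
proof (induction "\<delta> v" arbitrary: v rule: less_induct)
  case less
  show ?case
  proof (cases "v = r")
    case False
    then obtain u where u: "{u, v} \<in> E" "\<delta> v = Suc (\<delta> u)" using dist_parent by blast
    then have "u \<noteq> w" using less.prems by auto
    then have "(u, r) \<in> {(a, b). {a, b} \<in> E \<and> a \<noteq> w \<and> b \<noteq> w}\<^sup>*"
      using less.hyps[of u] u less.prems by auto
    moreover have "(v, u) \<in> {(a, b). {a, b} \<in> E \<and> a \<noteq> w \<and> b \<noteq> w}"
      using u \<open>u \<noteq> w\<close> less.prems by (simp add: insert_commute)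
    ultimately show ?thesis by (rule converse_rtrancl_into_rtrancl[rotated])
  qed simp
qed

text \<open>Otherwise walks of decreasing distance from \<open>v\<close> and \<open>v'\<close> to the root, which avoid \<open>w\<close>, would join to a path
from \<open>v\<close> to \<open>v'\<close> that closes up to a cycle through \<open>w\<close>. With equal or smaller distances, this excludes both
a second parent and an edge inside a level.\<close>

lemma lower_neighbour_unique:
  assumes v: "{w, v} \<in> E" "\<delta> v \<le> \<delta> w" and v': "{w, v'} \<in> E" "\<delta> v' \<le> \<delta> w"
  shows "v = v'"
proof (rule ccontr)
  assume neq: "v \<noteq> v'"
  let ?R = "{(a, b). {a, b} \<in> E \<and> a \<noteq> w \<and> b \<noteq> w}"
  have w: "v \<noteq> w" "v' \<noteq> w" using simple_graph_member[OF tree_simple] v v' by blast+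
  have "sym (?R\<^sup>*)" by (rule sym_rtrancl) (auto simp: sym_def insert_commute)
  then have "(v, v') \<in> ?R\<^sup>*"
    using reach_root_avoiding[OF v(2) w(1)] reach_root_avoiding[OF v'(2) w(2)]
    by (meson rtrancl_trans symD)
  from rtrancl_distinct_path[OF this]
  obtain xs where xs: "xs \<noteq> []" "hd xs = v" "last xs = v'" "distinct xs"
    "set xs \<subseteq> insert v (Range ?R)" "successively (\<lambda>a b. (a, b) \<in> ?R) xs" by blast
  have succ: "successively (\<lambda>a b. {a, b} \<in> E) xs"
    using xs(6) by (rule successively_mono) auto
  have "w \<notin> set xs" using xs(5) w by auto
  moreover have "length xs \<ge> 2"
    using xs neq by (cases xs; cases "tl xs") auto
  ultimately have "is_cycle E (w # xs)"
    using xs succ v(1) v'(1)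
    by (auto simp: is_cycle_def is_walk_def successively_Cons insert_commute)
  then show False using tree_acyclic by blast
qed

lemma edge_parent_child:
  assumes "{u, v} \<in> E"
  shows "v \<in> children E r u \<or> u \<in> children E r v"
proof -
  have "\<delta> u \<noteq> \<delta> v"
  proof
    assume eq: "\<delta> u = \<delta> v"
    have "u \<noteq> v" using simple_graph_member[OF tree_simple assms] .
    have "\<exists>a b. {a, b} \<in> E \<and> \<delta> a = \<delta> b \<and> a \<noteq> r"
    proof (cases "u = r")
      case True
      then show ?thesis using \<open>u \<noteq> v\<close> assms eq
        by (intro exI[of _ v] exI[of _ u]) (auto simp: insert_commute)
    qed (use assms eq in blast)
    then obtain a b where ab: "{a, b} \<in> E" "\<delta> a = \<delta> b" "a \<noteq> r" by blast
    obtain z where z: "{z, a} \<in> E" "\<delta> a = Suc (\<delta> z)" using dist_parent[OF ab(3)] by blast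
    have "z = b"
      by (rule lower_neighbour_unique[of a]) (use z ab in \<open>auto simp: insert_commute\<close>)
    then show False using z ab by simp
  qed
  moreover have "{v, u} \<in> E" using assms by (simp add: insert_commute)
  ultimately show ?thesis
    using dist_edge[OF assms] dist_edge[OF \<open>{v, u} \<in> E\<close>] assms unfolding children_def by auto
qed

text \<open>The condition that leaves lie at distance \<open>h\<close> bounds all distances: a vertex of maximal distance is a leaf.
Hence vertices at distance less than \<open>h\<close> are exactly those with children.\<close>

lemma perfect_tree_level_forest:
  assumes "\<forall>v. (children E r v \<noteq> {} \<longrightarrow> card (children E r v) = 2) \<and>
             (children E r v = {} \<longrightarrow> \<delta> v = h)"
  shows "binary_level_forest (children E r) \<delta> h" and "\<delta> v \<le> h"
proof -
  have le: "\<delta> v \<le> h" for v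
  proof -
    obtain u where u: "\<delta> u = Max (range \<delta>)" using Max_in[of "range \<delta>"] by fastforce
    have max: "\<delta> x \<le> \<delta> u" for x unfolding u by (rule Max_ge) auto
    have "children E r u = {}"
    proof (rule ccontr)
      assume "children E r u \<noteq> {}"
      then obtain x where "\<delta> x = Suc (\<delta> u)" unfolding children_def by blast
      then show False using max[of x] by simp
    qed
    then show ?thesis using assms max[of v] by auto
  qed
  then show "\<delta> v \<le> h" .
  show "binary_level_forest (children E r) \<delta> h"
  proof
    fix v v' w
    show "w \<in> children E r v \<Longrightarrow> \<delta> w = Suc (\<delta> v)" by (simp add: children_def)
    assume "w \<in> children E r v" "w \<in> children E r v'"
    then show "v = v'"
      by (intro lower_neighbour_unique[of w]) (auto simp: children_def insert_commute)
  next
    fix w n assume "\<delta> w = Suc n"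
    then have "w \<noteq> r" using dist_root by auto
    then show "\<exists>v. w \<in> children E r v" using dist_parent unfolding children_def by blast
  next
    fix v assume "\<delta> v < h"
    then show "card (children E r v) = 2" using assms by (metis less_irrefl)
  qed
qed

end

lemma perfect_binary_tree_last_betti:
  assumes "perfect_binary_tree T h"
  shows "\<exists>d. last_betti T d 1"
proof -
  obtain r where tree: "is_tree T" and r: "\<forall>v. (children T r v \<noteq> {} \<longrightarrow> card (children T r v) = 2) \<and>
             (children T r v = {} \<longrightarrow> graph_dist T r v = h)"
    using assms unfolding perfect_binary_tree_def by blast
  interpret binary_level_forest "children T r" "graph_dist T r" h
    by (rule perfect_tree_level_forest(1)[OF tree r])
  have "T = edges_below (Suc h)"
  proof
    show "T \<subseteq> edges_below (Suc h)"
    proof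
      fix e assume e: "e \<in> T"
      then have "card e = 2" using tree_simple[OF tree] by (simp add: simple_graph_def)
      then obtain u v where uv: "e = {u, v}" by (auto simp: card_2_iff)
      have lt: "graph_dist T r x < Suc h" for x
        using perfect_tree_level_forest(2)[OF tree r, of x] by simp
      from edge_parent_child[OF tree, of u v r] e uv
      consider "v \<in> children T r u" | "u \<in> children T r v" by blast
      then show "e \<in> edges_below (Suc h)"
      proof cases
        case 1
        then show ?thesis unfolding edges_below_def uv using lt by blast
      next
        case 2
        have "e = {v, u}" using uv by blast
        then show ?thesis unfolding edges_below_def using 2 lt by blast
      qed
    qed
    show "edges_below (Suc h) \<subseteq> T" by (auto simp: edges_below_def children_def)
  qed
  then show ?thesis using last_betti_edges_below[of "Suc h"] by simp
qed

theorem theorem1p4: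
  fixes T :: "'v::finite set set"
    and h :: nat
    and I :: "('v, 'k::field) polyring set"
  assumes "perfect_binary_tree T h" and "h > 0"
    and "I = edge_ideal T"
  shows "betti I (proj_dim I) = 1"
proof -
  have "simple_graph T"
    using assms(1) by (simp add: perfect_binary_tree_def is_tree_def)
  then have I: "I = sqfree_ideal T"
    using assms(3) edge_ideal_eq_sqfree_ideal by blast
  obtain d where "last_betti T d 1"
    using perfect_binary_tree_last_betti[OF assms(1)] by blast
  then show ?thesis unfolding I by (rule last_betti_betti_proj_dim)
qed

end
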